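(* Let $(E,d)$ be a complete separable metric space, and let $A$ be an operator with domain $\mathcal{D}(A)\subset C_b(E)$ and range contained in $M(E)$. Assume: (1) there is a Borel measurable function $\Phi:E\to[0,\infty)$ such that for every $f\in\mathcal{D}(A)$ there is a constant $C_f<\infty$ with $|Af(x)|\le C_f\Phi(x)$ for all $x\in E$; (2) there is a countable set $\{f_n:n\ge1\}\subset\mathcal{D}(A)$ such that the bp-closure of $\{(f_n,\Phi^{-1}Af_n):n\ge1\}$ contains $\{(f,\Phi^{-1}Af):f\in\mathcal{D}(A)\}$; (3) for each $x\in E$, the martingale problem for $(A,\delta_x)$ is well-posed in the class of solutions that are continuous in probability. For $x\in E$ let $X^x$ denote a solution to the $(A,\delta_x)$ martingale problem that is continuous in probability, and for $t\in[0,\infty)$, $x\in E$ and Borel $B\subset E$ let $p_t(x,B)=P(X^x_t\in B)$. Then for all $t\in[0,\infty)$ and all Borel $B\subset E$, the map $x\mapsto p_t(x,B)$ is Borel measurable.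
   Context: $C_b(E)$, $M(E)$, $B(E)$ are the bounded continuous, the Borel measurable, and the bounded Borel measurable real-valued functions on $E$; $\mathcal{P}(E)$ is the set of Borel probability measures on $E$; $\mathcal{L}$ denotes law. The bp-closure of a set of pairs of functions in $B(E)\times B(E)$ is the smallest set containing it that is closed under bounded pointwise convergence of sequences. The function $\Phi^{-1}Af$ is $Af/\Phi$, read as $0$ where $\Phi=0$ (there $Af=0$ as well). A process is measurable if $(t,\omega)\mapsto X_t(\omega)$ is jointly measurable, and then ${}^*\mathcal{F}^X_t=\sigma\{X_u,\ \int_0^u h(X_s)\,ds:\ u\le t,\ h\in C_b(E)\}$. A process $X=(X_t)_{0\le t<\infty}$ on $(\Omega,\mathcal{F},\mathbb{P})$ is a solution to the martingale problem for $(A,\lambda)$, $\lambda\in\mathcal{P}(E)$, if $X$ is a measurable $E$-valued process with $\mathcal{L}(X_0)=\lambda$; $\mathbb{E}_{\mathbb{P}}[\int_0^T\Phi(X_s)\,ds]<\infty$ for all $T<\infty$; and for every $f\in\mathcal{D}(A)$, $f(X_t)-\int_0^tAf(X_s)\,ds$ is a $({}^*\mathcal{F}^X_t)$-martingale. $X$ is continuous in probability if $d(X_{s_k},X_s)\to0$ in probability whenever $s_k\to s$. The martingale problem for $(A,\lambda)$ is well-posed in the class of solutions that are continuous in probability if there exists a solution that is continuous in probability and any two such solutions (possibly on different probability spaces) have the same finite-dimensional distributions. *)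

theory Defs
  imports "HOL-Probability.Probability"
begin

text \<open>
  Processes are functions \<open>X :: real \<Rightarrow> 'w \<Rightarrow> 'a\<close>; only the values at times
  \<open>t \<ge> 0\<close> are ever used. An operator with domain \<open>D\<close> is a map \<open>A\<close> on functions of which
  only the values on \<open>D\<close> are used; no linearity is assumed.
\<close>

definition Cb :: "('a::topological_space \<Rightarrow> real) set" where
  "Cb = {f. continuous_on UNIV f \<and> bounded (range f)}"

inductive_set bp_closure ::
    "(('a \<Rightarrow> real) \<times> ('a \<Rightarrow> real)) set \<Rightarrow> (('a \<Rightarrow> real) \<times> ('a \<Rightarrow> real)) set"
  for S where
    base: "p \<in> S \<Longrightarrow> p \<in> bp_closure S"
  | lim: "(\<And>n::nat. (g n, h n) \<in> bp_closure S) \<Longrightarrow>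
          (\<And>n x. \<bar>g n x\<bar> \<le> C) \<Longrightarrow> (\<And>n x. \<bar>h n x\<bar> \<le> C) \<Longrightarrow>
          (\<And>x. (\<lambda>n. g n x) \<longlonglongrightarrow> g' x) \<Longrightarrow> (\<And>x. (\<lambda>n. h n x) \<longlonglongrightarrow> h' x) \<Longrightarrow>
          (g', h') \<in> bp_closure S"

definition measurable_process ::
    "'w measure \<Rightarrow> (real \<Rightarrow> 'w \<Rightarrow> 'a::topological_space) \<Rightarrow> bool" where
  "measurable_process M X \<longleftrightarrow>
     (\<lambda>(t, \<omega>). X t \<omega>) \<in> restrict_space borel {0..} \<Otimes>\<^sub>M M \<rightarrow>\<^sub>M borel"

definition star_filtration ::
    "'w measure \<Rightarrow> (real \<Rightarrow> 'w \<Rightarrow> 'a::topological_space) \<Rightarrow> real \<Rightarrow> 'w measure" where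
  "star_filtration M X t = sigma (space M)
     ({X u -` B \<inter> space M | u B. 0 \<le> u \<and> u \<le> t \<and> B \<in> sets borel} \<union>
      {(\<lambda>\<omega>. LINT s:{0..u}|lborel. h (X s \<omega>)) -` B \<inter> space M | u h B.
         0 \<le> u \<and> u \<le> t \<and> h \<in> Cb \<and> B \<in> sets borel})"

definition is_martingale ::
    "'w measure \<Rightarrow> (real \<Rightarrow> 'w measure) \<Rightarrow> (real \<Rightarrow> 'w \<Rightarrow> real) \<Rightarrow> bool" where
  "is_martingale M F Y \<longleftrightarrow>
     (\<forall>t\<ge>0. subalgebra M (F t)) \<and>
     (\<forall>s t. 0 \<le> s \<and> s \<le> t \<longrightarrow> subalgebra (F t) (F s)) \<and>
     (\<forall>t\<ge>0. Y t \<in> borel_measurable (F t) \<and> integrable M (Y t)) \<and>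
     (\<forall>s t. 0 \<le> s \<and> s \<le> t \<longrightarrow> (AE \<omega> in M. real_cond_exp M (F s) (Y t) \<omega> = Y s \<omega>))"

text \<open>
  Under the integrability condition on \<open>\<Phi>\<close> and the bound \<open>\<bar>A f\<bar> \<le> C * \<Phi>\<close>, the time integral of
  \<open>A f (X s \<omega>)\<close> converges absolutely for almost every \<open>\<omega>\<close>; on the exceptional null set it has
  the default value \<open>0\<close>, which keeps it adapted to the (uncompleted) filtration.
\<close>

definition mp_solution ::
    "('a::polish_space \<Rightarrow> real) set \<Rightarrow> (('a \<Rightarrow> real) \<Rightarrow> 'a \<Rightarrow> real) \<Rightarrow> ('a \<Rightarrow> real) \<Rightarrow>
     'a measure \<Rightarrow> 'w measure \<Rightarrow> (real \<Rightarrow> 'w \<Rightarrow> 'a) \<Rightarrow> bool" where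
  "mp_solution D A \<Phi> \<nu> M X \<longleftrightarrow>
     prob_space M \<and> measurable_process M X \<and> distr M borel (X 0) = \<nu> \<and>
     (\<forall>T\<ge>0. (\<integral>\<^sup>+\<omega>. (\<integral>\<^sup>+s\<in>{0..T}. ennreal (\<Phi> (X s \<omega>)) \<partial>lborel) \<partial>M) < \<infinity>) \<and>
     (\<forall>f\<in>D. is_martingale M (star_filtration M X)
        (\<lambda>t \<omega>. f (X t \<omega>) - (LINT s:{0..t}|lborel. A f (X s \<omega>))))"

definition continuous_in_probability ::
    "'w measure \<Rightarrow> (real \<Rightarrow> 'w \<Rightarrow> 'a::metric_space) \<Rightarrow> bool" where
  "continuous_in_probability M X \<longleftrightarrow>
     (\<forall>s sk. 0 \<le> s \<and> (\<forall>k::nat. 0 \<le> sk k) \<and> sk \<longlonglongrightarrow> s \<longrightarrow>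
        (\<forall>\<epsilon>>0. (\<lambda>k. measure M {\<omega> \<in> space M. dist (X (sk k) \<omega>) (X s \<omega>) > \<epsilon>}) \<longlonglongrightarrow> 0))"

definition same_fdd ::
    "'w measure \<Rightarrow> (real \<Rightarrow> 'w \<Rightarrow> 'a::topological_space) \<Rightarrow>
     'v measure \<Rightarrow> (real \<Rightarrow> 'v \<Rightarrow> 'a) \<Rightarrow> bool" where
  "same_fdd M X N Y \<longleftrightarrow>
     (\<forall>J. finite J \<and> J \<subseteq> {0..} \<longrightarrow>
        distr M (\<Pi>\<^sub>M j\<in>J. borel) (\<lambda>\<omega>. \<lambda>j\<in>J. X j \<omega>) =
        distr N (\<Pi>\<^sub>M j\<in>J. borel) (\<lambda>\<omega>. \<lambda>j\<in>J. Y j \<omega>))"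

text \<open>
  HOL cannot quantify over all sample spaces of all types inside a formula. Well-posedness
  quantifies over all probability spaces whose points are real numbers (with arbitrary
  \<open>\<sigma>\<close>-algebra and measure), and this loses nothing: since the state space is second countable, a
  measurable process is already jointly measurable for some countably generated sub-\<open>\<sigma>\<close>-algebra
  of events, hence is of the form \<open>X t \<omega> = Y t (\<phi> \<omega>)\<close> for \<open>t \<ge> 0\<close>, with \<open>\<phi>\<close> a real random
  variable and \<open>Y\<close> a measurable process on the reals with their Borel sets, under the law of
  \<open>\<phi>\<close>. The processes \<open>X\<close> and \<open>Y\<close> have the same finite-dimensional distributions, \<open>\<phi>\<close> pulls the
  filtration of \<open>Y\<close> back to that of \<open>X\<close>, and \<open>X\<close> is a solution (continuous in probability) iff
  \<open>Y\<close> is. So both existence and uniqueness agree with their unrestricted versions.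
\<close>

definition mp_well_posed ::
    "('a::polish_space \<Rightarrow> real) set \<Rightarrow> (('a \<Rightarrow> real) \<Rightarrow> 'a \<Rightarrow> real) \<Rightarrow> ('a \<Rightarrow> real) \<Rightarrow>
     'a measure \<Rightarrow> bool" where
  "mp_well_posed D A \<Phi> \<nu> \<longleftrightarrow>
     (\<exists>(M :: real measure) X. mp_solution D A \<Phi> \<nu> M X \<and> continuous_in_probability M X) \<and>
     (\<forall>(M :: real measure) X (N :: real measure) Y.
        mp_solution D A \<Phi> \<nu> M X \<and> continuous_in_probability M X \<and>
        mp_solution D A \<Phi> \<nu> N Y \<and> continuous_in_probability N Y \<longrightarrow> same_fdd M X N Y)"

end

theory Submission
  imports Defs
begin

text \<open>
  A solution that is continuous in probability is determined by its values at rational times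
  together with a modulus of continuity in probability, so it can be coded by a point \<open>z\<close> of a
  Polish space: a distribution function on the rationals, which encodes the law of the path at
  rational times, and an integer sequence giving the modulus. Being the code of a solution started
  at \<open>x\<close> amounts to countably many conditions that are Borel in \<open>(x, z)\<close>: the time integrals
  see only almost every time, and the bp-closure assumption reduces the martingale property to
  countably many functions, rational times and test events.

  Uniqueness shows that all codes of solutions started at \<open>x\<close> give the same value
  \<open>P z = p\<^sub>t(x, B)\<close>. Hence both \<open>{x. p\<^sub>t(x, B) \<le> a}\<close> and its complement are projections of
  Borel sets, and they are Borel by Suslin's theorem.
\<close>

section \<open>Separation of projections of Borel sets\<close>

text \<open>A process that is merely continuous in probability has no regular sample paths, so there
  is no evident Polish path space to carry its law. It is rebuilt instead as an almost sure limit
  along grids fine enough for its modulus. Asking that some modulus exist would quantify over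
  sequences and spoil the Borel property, so the modulus is made part of the code. All expectations
  are taken on one fixed space, (0,1) with Lebesgue measure; the law enters as a parameter of the
  random path, and Fubini makes each condition Borel in it. A solution has many codes, and a law has
  many parameters. The set of codes is therefore not a graph over the starting points, which is why
  two complementary projections are used. The given solutions may live on any sample space, whereas
  the uniqueness hypothesis speaks of real sample points. Each given solution is therefore compared
  with its code through laws, and uniqueness is applied only between decoded processes on
  (0,1).\<close>

definition borel_separated :: "'a::topological_space set \<Rightarrow> 'a set \<Rightarrow> bool" where
  "borel_separated P Q \<longleftrightarrow> (\<exists>S\<in>sets borel. P \<subseteq> S \<and> Q \<inter> S = {})"

text \<open>The separator is assembled from the pairwise ones as
  \<open>\<Union>m. \<Inter>n. S m n\<close>. It serves in contrapositive form: if two countable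
  unions cannot be separated, neither can some pair of their pieces.\<close>

lemma borel_separated_UN:
  fixes P Q :: "nat \<Rightarrow> 'a::topological_space set"
  assumes "\<And>m n. borel_separated (P m) (Q n)"
  shows "borel_separated (\<Union>m. P m) (\<Union>n. Q n)"
proof -
  obtain S where S: "\<And>m n. S m n \<in> sets borel" "\<And>m n. P m \<subseteq> S m n" "\<And>m n. Q n \<inter> S m n = {}"
    using assms unfolding borel_separated_def by metis
  have "(\<Union>m. \<Inter>n. S m n) \<in> sets borel"
    using S(1) by (intro sets.countable_UN sets.countable_INT) auto
  moreover have "(\<Union>m. P m) \<subseteq> (\<Union>m. \<Inter>n. S m n)"
    using S(2) by blast
  moreover have "(\<Union>n. Q n) \<inter> (\<Union>m. \<Inter>n. S m n) = {}"
    using S(3) by blast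
  ultimately show ?thesis
    unfolding borel_separated_def by (intro bexI[of _ "\<Union>m. \<Inter>n. S m n"] conjI)
qed

lemma dense_sequence:
  obtains e :: "nat \<Rightarrow> 'a::{metric_space, second_countable_topology}"
  where "\<And>x r. 0 < r \<Longrightarrow> \<exists>i. dist x (e i) < r"
proof -
  obtain D :: "'a set" where D: "countable D" "\<And>X. open X \<Longrightarrow> X \<noteq> {} \<Longrightarrow> \<exists>d\<in>D. d \<in> X"
    using countable_dense_exists by auto
  have "D \<noteq> {}"
    using D(2)[of UNIV] by auto
  have "\<exists>i. dist x (from_nat_into D i) < r" if "0 < r" for x r
    using D(2)[of "ball x r"] that from_nat_into_surj[OF D(1)] by fastforce
  then show thesis
    using that by blast
qed

text \<open>Lusin separation by contradiction. Splitting both sets into countably many small closed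
  pieces keeps some pair inseparable. The nested pairs shrink to one point on each side, and
  disjoint open neighbourhoods of the two images finally separate a pair.\<close>

lemma borel_separated_closed_images:
  fixes p :: "'w::{complete_space, second_countable_topology} \<Rightarrow> 'a::t2_space"
  assumes p: "continuous_on UNIV p" and C: "closed C" "closed D" and disj: "p ` C \<inter> p ` D = {}"
  shows "borel_separated (p ` C) (p ` D)"
proof (rule ccontr)
  assume not_sep: "\<not> borel_separated (p ` C) (p ` D)"
  obtain e :: "nat \<Rightarrow> 'w" where e: "\<And>x r. 0 < r \<Longrightarrow> \<exists>i. dist x (e i) < r"
    using dense_sequence by blast
  define V where "V n i = cball (e i) ((1/2)^n)" for n :: nat and i
  have V_cover: "(\<Union>i. V n i) = UNIV" for n
    using e[of "(1/2)^n"] unfolding V_def by (auto simp: dist_commute) (metis less_imp_le)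
  let ?small = "\<lambda>n (a :: 'w set). \<exists>i. a \<subseteq> V n i"
  define inv where "inv s \<longleftrightarrow> closed (fst s) \<and> closed (snd s) \<and>
    \<not> borel_separated (p ` fst s) (p ` snd s)" for s :: "'w set \<times> 'w set"
  have step: "\<exists>s'. inv s' \<and> fst s' \<subseteq> fst s \<and> snd s' \<subseteq> snd s \<and> ?small n (fst s') \<and> ?small n (snd s')"
    if s: "inv s" for s n
  proof -
    obtain a b where [simp]: "s = (a, b)" by (cases s)
    have split: "p ` a = (\<Union>i. p ` (a \<inter> V n i))" for a
      using V_cover[of n] by blast
    have "\<exists>i j. \<not> borel_separated (p ` (a \<inter> V n i)) (p ` (b \<inter> V n j))"
      using s borel_separated_UN[of "\<lambda>i. p ` (a \<inter> V n i)" "\<lambda>i. p ` (b \<inter> V n i)"]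
      unfolding inv_def by (auto simp flip: split)
    then obtain i j where "\<not> borel_separated (p ` (a \<inter> V n i)) (p ` (b \<inter> V n j))"
      by blast
    then show ?thesis
      using s by (intro exI[of _ "(a \<inter> V n i, b \<inter> V n j)"]) (auto simp: V_def inv_def intro: closed_Int)
  qed
  define nxt where "nxt n s = (SOME s'. inv s' \<and> fst s' \<subseteq> fst s \<and> snd s' \<subseteq> snd s \<and>
    ?small n (fst s') \<and> ?small n (snd s'))" for n s
  define s where "s = rec_nat (C, D) nxt"
  have s_Suc: "inv (s (Suc n)) \<and> fst (s (Suc n)) \<subseteq> fst (s n) \<and> snd (s (Suc n)) \<subseteq> snd (s n) \<and>
    ?small n (fst (s (Suc n))) \<and> ?small n (snd (s (Suc n)))" if "inv (s n)" for n
    using someI_ex[OF step[OF that, of n]] unfolding s_def nxt_def by simp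
  have s0: "inv (s 0)"
    using C not_sep by (simp add: s_def inv_def)
  have inv_s: "inv (s n)" for n
  proof (induction n)
    case (Suc n)
    then show ?case using s_Suc[of n] by blast
  qed (use s0 in blast)
  have s: "fst (s (Suc n)) \<subseteq> fst (s n)" "snd (s (Suc n)) \<subseteq> snd (s n)"
    "?small n (fst (s (Suc n)))" "?small n (snd (s (Suc n)))" for n
    using s_Suc[OF inv_s] by auto
  have s_inv: "closed (fst (s n))" "closed (snd (s n))" "\<not> borel_separated (p ` fst (s n)) (p ` snd (s n))" for n
    using inv_s[of n] by (auto simp: inv_def)
  \<comment> \<open>Cantor's intersection theorem, together with the fact that the sets eventually
    enter every ball around the common point.\<close>
  have limit: "\<exists>x. (\<forall>n. x \<in> a n) \<and> (\<forall>r>0. \<exists>N. \<forall>n\<ge>N. a n \<subseteq> ball x r)"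
    if a: "\<And>n. closed (a n)" "\<And>n. a n \<noteq> {}" "\<And>n. a (Suc n) \<subseteq> a n" "\<And>n. ?small n (a (Suc n))"
    for a :: "nat \<Rightarrow> 'w set"
  proof -
    have dec: "a n \<subseteq> a m" if "m \<le> n" for m n
      using a(3) that by (metis lift_Suc_antimono_le)
    have diam: "\<exists>n. \<forall>x\<in>a n. \<forall>y\<in>a n. dist x y < r" if "0 < r" for r
    proof -
      obtain n where n: "(1/2)^n < r/2"
        using real_arch_pow_inv[of "r/2" "1/2"] \<open>0 < r\<close> by auto
      obtain i where i: "a (Suc n) \<subseteq> V n i"
        using a(4) by blast
      have "dist x y < r" if "x \<in> a (Suc n)" "y \<in> a (Suc n)" for x y
      proof -
        have "dist (e i) x \<le> (1/2)^n" "dist (e i) y \<le> (1/2)^n"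
          using i that unfolding V_def by auto
        then show ?thesis
          using dist_triangle3[of x y "e i"] n by linarith
      qed
      then show ?thesis by blast
    qed
    obtain x where x: "\<And>n. x \<in> a n"
      using decreasing_closed_nest[of a] a(1,2) dec diam by (metis (no_types, lifting))
    have "\<exists>N. \<forall>n\<ge>N. a n \<subseteq> ball x r" if "0 < r" for r
    proof -
      obtain N where "\<forall>x\<in>a N. \<forall>y\<in>a N. dist x y < r"
        using diam[OF \<open>0 < r\<close>] by blast
      then show ?thesis
        using x dec by (intro exI[of _ N]) (auto, meson subsetD)
    qed
    then show ?thesis
      using x by blast
  qed
  \<comment> \<open>The empty set is separated from every set, so both members of an inseparable
    pair are nonempty.\<close>
  have ne: "fst (s n) \<noteq> {}" "snd (s n) \<noteq> {}" for n
  proof -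
    have 1: "borel_separated {} Q" "borel_separated Q {}" for Q :: "'a set"
      unfolding borel_separated_def by (auto intro: bexI[of _ "{}"] bexI[of _ UNIV])
    show "fst (s n) \<noteq> {}" "snd (s n) \<noteq> {}"
      using s_inv(3)[of n] 1 by auto
  qed
  obtain x where x: "\<And>n. x \<in> fst (s n)" "\<And>r. 0 < r \<Longrightarrow> \<exists>N. \<forall>n\<ge>N. fst (s n) \<subseteq> ball x r"
    using limit[of "\<lambda>n. fst (s n)", OF s_inv(1) ne(1) s(1) s(3)] by blast
  obtain y where y: "\<And>n. y \<in> snd (s n)" "\<And>r. 0 < r \<Longrightarrow> \<exists>N. \<forall>n\<ge>N. snd (s n) \<subseteq> ball y r"
    using limit[of "\<lambda>n. snd (s n)", OF s_inv(2) ne(2) s(2) s(4)] by blast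
  have "p x \<noteq> p y"
    using x(1)[of 0] y(1)[of 0] disj by (auto simp: s_def)
  then obtain U W where UW: "open U" "open W" "p x \<in> U" "p y \<in> W" "U \<inter> W = {}"
    using hausdorff by metis
  have "open (p -` U)" "open (p -` W)"
    using p UW by (auto intro: open_vimage)
  then obtain r where r: "0 < r" "ball x r \<subseteq> p -` U" "ball y r \<subseteq> p -` W"
  proof -
    obtain r1 r2 where "0 < r1" "ball x r1 \<subseteq> p -` U" "0 < r2" "ball y r2 \<subseteq> p -` W"
      using UW \<open>open (p -` U)\<close> \<open>open (p -` W)\<close> openE[of "p -` U" x] openE[of "p -` W" y] by (metis vimageI)
    then show thesis
      by (intro that[of "min r1 r2"]) auto
  qed
  obtain N1 N2 where "\<forall>n\<ge>N1. fst (s n) \<subseteq> ball x r" "\<forall>n\<ge>N2. snd (s n) \<subseteq> ball y r"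
    using x(2) y(2) r(1) by metis
  then have "fst (s (max N1 N2)) \<subseteq> ball x r" "snd (s (max N1 N2)) \<subseteq> ball y r"
    by auto
  then have "p ` fst (s (max N1 N2)) \<subseteq> U" "p ` snd (s (max N1 N2)) \<inter> U = {}"
    using r UW by blast+
  then have "borel_separated (p ` fst (s (max N1 N2))) (p ` snd (s (max N1 N2)))"
    unfolding borel_separated_def using borel_open[OF UW(1)] by (intro bexI[of _ U] conjI)
  then show False
    using s_inv(3) by blast
qed

section \<open>Borel sets as projections of closed sets along Baire space\<close>

text \<open>The wrapper \<open>discrete\<close> supplies the discrete metric, so functions into it
  carry the topology of Baire space and fixing a coordinate is a clopen condition.\<close>

type_synonym baire = "nat \<Rightarrow> nat discrete"

text \<open>The first entry of the sequence names a set containing \<open>w\<close>, and the tail is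
  the witness for that set. \<open>T\<close> is closed because each condition "the first entry is
  not \<open>n\<close>, or the tail is a witness for \<open>C n\<close>" is a union of two closed
  sets.\<close>

lemma closed_projection_countable_Un:
  fixes B :: "nat \<Rightarrow> 'w::topological_space set"
  assumes "\<And>n. \<exists>C :: ('w \<times> baire) set. closed C \<and> B n = fst ` C"
  shows "\<exists>C :: ('w \<times> baire) set. closed C \<and> (\<Union>n. B n) = fst ` C"
proof -
  obtain C :: "nat \<Rightarrow> ('w \<times> baire) set" where C: "\<And>n. closed (C n)" "\<And>n. B n = fst ` C n"
    using assms by metis
  define T where "T = (\<Inter>n. (\<lambda>v. snd v 0) -` (- {discrete n}) \<union> (\<lambda>v. (fst v, \<lambda>k. snd v (Suc k))) -` C n)"
  have c1: "continuous_on UNIV (\<lambda>v::'w \<times> baire. snd v 0)"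
    by (rule continuous_on_product_then_coordinatewise) (intro continuous_intros)
  have c2: "continuous_on UNIV (\<lambda>v::'w \<times> baire. (fst v, \<lambda>k. snd v (Suc k)))"
    by (intro continuous_intros continuous_on_coordinatewise_then_product
        continuous_on_product_then_coordinatewise[where f = snd])
  have "closed (- {discrete n})" for n :: nat
    unfolding closed_def by (rule open_discrete)
  then have "closed T"
    unfolding T_def using c1 c2 C(1) by (intro closed_INT closed_Un ballI) (auto intro: closed_vimage)
  moreover have T_iff: "(w, \<alpha>) \<in> T \<longleftrightarrow> (w, \<lambda>k. \<alpha> (Suc k)) \<in> C (of_discrete (\<alpha> 0))" for w \<alpha>
  proof -
    have "\<alpha> 0 = discrete n \<longleftrightarrow> of_discrete (\<alpha> 0) = n" for n
      using of_discrete_inverse discrete_inverse[of n] by (metis UNIV_I)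
    then show ?thesis
      unfolding T_def by auto
  qed
  have "(\<Union>n. B n) = fst ` T"
  proof safe
    fix w n assume "w \<in> B n"
    then obtain \<alpha> where "(w, \<alpha>) \<in> C n"
      using C(2) by auto
    then have "(w, case_nat (discrete n) \<alpha>) \<in> T"
      unfolding T_iff by (simp add: discrete_inverse)
    then show "w \<in> fst ` T"
      by force
  next
    fix w \<alpha> assume "(w, \<alpha>) \<in> T"
    then show "fst (w, \<alpha>) \<in> (\<Union>n. B n)"
      unfolding T_iff using C(2) by force
  qed
  ultimately show ?thesis by blast
qed

text \<open>One sequence stores countably many witnesses, interleaved by \<open>prod_encode\<close>.
  Each constraint is then the preimage of a closed set under a continuous map.\<close>

lemma closed_projection_countable_Int:
  fixes B :: "nat \<Rightarrow> 'w::topological_space set"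
  assumes "\<And>n. \<exists>C :: ('w \<times> baire) set. closed C \<and> B n = fst ` C"
  shows "\<exists>C :: ('w \<times> baire) set. closed C \<and> (\<Inter>n. B n) = fst ` C"
proof -
  obtain C :: "nat \<Rightarrow> ('w \<times> baire) set" where C: "\<And>n. closed (C n)" "\<And>n. B n = fst ` C n"
    using assms by metis
  define T where "T = (\<Inter>n. (\<lambda>v. (fst v, \<lambda>k. snd v (prod_encode (n, k)))) -` C n)"
  have c: "continuous_on UNIV (\<lambda>v::'w \<times> baire. (fst v, \<lambda>k. snd v (prod_encode (n, k))))" for n
    by (intro continuous_intros continuous_on_coordinatewise_then_product
        continuous_on_product_then_coordinatewise[where f = snd])
  have "closed T"
    unfolding T_def using c C(1) by (intro closed_INT ballI) (auto intro: closed_vimage)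
  moreover have "(\<Inter>n. B n) = fst ` T"
  proof safe
    fix w assume "w \<in> (\<Inter>n. B n)"
    then have "\<forall>n. \<exists>\<alpha>. (w, \<alpha>) \<in> C n"
      using C(2) by fastforce
    then obtain \<alpha> where "\<And>n. (w, \<alpha> n) \<in> C n"
      by metis
    then have "(w, \<lambda>m. \<alpha> (fst (prod_decode m)) (snd (prod_decode m))) \<in> T"
      unfolding T_def by simp
    then show "w \<in> fst ` T"
      by force
  next
    fix w \<alpha> n assume "(w, \<alpha>) \<in> T"
    then show "fst (w, \<alpha>) \<in> B n"
      unfolding T_def using C(2) by force
  qed
  ultimately show ?thesis by blast
qed

lemma closed_projection_closed:
  assumes "closed B"
  shows "\<exists>C :: ('w::topological_space \<times> baire) set. closed C \<and> B = fst ` C"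
  using assms by (intro exI[of _ "B \<times> UNIV"]) (auto intro: closed_Times)

text \<open>In a metric space an open set is a countable union of closed sets, cut out by the
  distance to its complement.\<close>

lemma closed_projection_open:
  fixes U :: "'w::metric_space set"
  assumes "open U"
  shows "\<exists>C :: ('w \<times> baire) set. closed C \<and> U = fst ` C"
\<comment> \<open>\<open>infdist\<close> to the empty set is 0 by convention, so the whole space
  needs its own case.\<close>
proof (cases "U = UNIV")
  case True
  then show ?thesis
    using closed_projection_closed[of U] by simp
next
  case False
  have "U = (\<Union>n. {w. 1 / Suc n \<le> infdist w (- U)})"
  proof safe
    fix w assume "w \<in> U"
    then have "infdist w (- U) > 0"
      using assms False in_closed_iff_infdist_zero[of "- U" w] infdist_nonneg[of w "- U"] by fastforce
    then show "w \<in> (\<Union>n. {w. 1 / Suc n \<le> infdist w (- U)})"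
      using nat_approx_posE by (metis (mono_tags, lifting) UNIV_I UN_I less_imp_le mem_Collect_eq)
  next
    fix w n assume "1 / real (Suc n) \<le> infdist w (- U)"
    then show "w \<in> U"
      using infdist_zero[of w "- U"] by (cases "w \<in> U") (auto simp: field_simps)
  qed
  moreover have "closed {w. 1 / real (Suc n) \<le> infdist w (- U)}" for n
    by (intro closed_Collect_le continuous_intros)
  ultimately show ?thesis
    using closed_projection_countable_Un[of "\<lambda>n. {w. 1 / Suc n \<le> infdist w (- U)}"]
      closed_projection_closed by metis
qed

text \<open>Projections of closed sets need not be stable under complements, so the induction over
  the generated \<sigma>-algebra carries a set and its complement together.\<close>

lemma borel_eq_closed_projection:
  fixes B :: "'w::metric_space set"
  assumes "B \<in> sets borel"
  shows "\<exists>C :: ('w \<times> baire) set. closed C \<and> B = fst ` C"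
proof -
  let ?P = "\<lambda>B. \<exists>C :: ('w \<times> baire) set. closed C \<and> B = fst ` C"
  have "B \<in> sigma_sets UNIV {S. open S}"
    using assms by (simp add: borel_def)
  then have "?P B \<and> ?P (- B)"
  proof induction
    case (Basic U)
    then show ?case
      using closed_projection_open[of U] closed_projection_closed[of "- U"] by auto
  next
    case Empty
    then show ?case
      using closed_projection_closed[of "{}"] closed_projection_closed[of UNIV] by auto
  next
    case (Compl U)
    then show ?case by (simp add: Compl_eq_Diff_UNIV double_diff)
  next
    case (Union U)
    then show ?case
      using closed_projection_countable_Un[of U] closed_projection_countable_Int[of "\<lambda>n. - U n"]
      by (simp add: Compl_UN)
  qed
  then show ?thesis ..
qed

text \<open>Both projections are continuous images of closed sets of a Polish space, hence separated
  by a Borel set. A separator of complementary sets must equal the first of them.\<close>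

theorem borel_of_complementary_projections:
  fixes G H :: "('a::polish_space \<times> 'z::{complete_space, second_countable_topology}) set"
  assumes "G \<in> sets borel" "H \<in> sets borel" and compl: "fst ` H = - fst ` G"
  shows "fst ` G \<in> sets borel"
proof -
  obtain C D :: "(('a \<times> 'z) \<times> baire) set" where
    C: "closed C" "G = fst ` C" and D: "closed D" "H = fst ` D"
    using assms(1,2) borel_eq_closed_projection by metis
  have eq: "fst ` G = (\<lambda>v. fst (fst v)) ` C" "fst ` H = (\<lambda>v. fst (fst v)) ` D"
    using C D by (auto simp: image_image)
  have "borel_separated (fst ` G) (fst ` H)"
    unfolding eq using C(1) D(1) compl[unfolded eq]
    by (intro borel_separated_closed_images continuous_intros) auto
  then obtain S where "S \<in> sets borel" "fst ` G \<subseteq> S" "fst ` H \<inter> S = {}"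
    unfolding borel_separated_def by blast
  then have "fst ` G = S"
    unfolding compl by blast
  with \<open>S \<in> sets borel\<close> show ?thesis by simp
qed

section \<open>Parametrising the laws on a Polish space\<close>

text \<open>On every divergent sequence \<open>lim\<close> has the same value
  \<open>THE x. False\<close>, so only the measurable set where the sequence is Cauchy needs an
  argument.\<close>

lemma borel_measurable_lim_polish:
  fixes f :: "nat \<Rightarrow> 'a \<Rightarrow> 'b::polish_space"
  assumes [measurable]: "\<And>i. f i \<in> borel_measurable M"
  shows "(\<lambda>x. lim (\<lambda>i. f i x)) \<in> borel_measurable M"
proof -
  define c :: 'b where "c = undefined"
  \<comment> \<open>Where the sequence is not Cauchy it is replaced by a constant one; the modified
    sequence converges everywhere.\<close>
  define u where "u x = lim (\<lambda>i. if Cauchy (\<lambda>i. f i x) then f i x else c)" for x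
  have lim_eq: "lim (\<lambda>i. f i x) = (if Cauchy (\<lambda>i. f i x) then u x else (THE x. False))" for x
    unfolding u_def by (auto simp: lim_def convergent_eq_Cauchy[symmetric])
  have "u \<in> borel_measurable M"
  proof (rule borel_measurable_LIMSEQ_metric)
    fix x
    have "convergent (\<lambda>i. if Cauchy (\<lambda>i. f i x) then f i x else c)"
      by (cases "Cauchy (\<lambda>i. f i x)") (auto simp: Cauchy_convergent convergent_const)
    then show "(\<lambda>i. if Cauchy (\<lambda>i. f i x) then f i x else c) \<longlonglongrightarrow> u x"
      unfolding u_def by (simp add: convergent_LIMSEQ_iff)
  qed measurable
  then show ?thesis
    unfolding lim_eq by measurable
qed

section \<open>Coding points of a Polish space by real numbers\<close>

text \<open>Base 3 with digits 0 and 1 excludes carries: the tail behind any position is at most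
  1/2, whereas in base 2 it could reach 1 and make the digits ambiguous.\<close>

lemma ternary_digit:
  fixes b :: "nat \<Rightarrow> bool"
  shows "\<lfloor>(\<Sum>i. of_bool (b i) / 3 ^ Suc i) * 3 ^ Suc n :: real\<rfloor> mod 3 = of_bool (b n)"
proof -
  have le: "of_bool (b i) / 3 ^ Suc i \<le> (1/3 :: real) ^ Suc i" for i :: nat and b :: "nat \<Rightarrow> bool"
    by (simp add: power_divide divide_right_mono)
  have geo: "(\<lambda>i. (1/3::real) ^ Suc i) sums (1/2)"
    using sums_mult[OF geometric_sums[of "1/3::real"], of "1/3"] by simp
  have sm: "summable (\<lambda>i. of_bool (b i) / 3 ^ Suc i :: real)" for b :: "nat \<Rightarrow> bool"
    by (rule summable_comparison_test'[OF sums_summable[OF geo], of 0]) (use le in auto)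
  \<comment> \<open>The rescaled tail behind the first \<open>n + 1\<close> digits. It is below 1,
    so the floor removes it.\<close>
  define r where "r = (\<Sum>i. of_bool (b (i + Suc n)) / 3 ^ Suc i :: real)"
  have r: "0 \<le> r" "r \<le> 1/2"
    unfolding r_def using suminf_nonneg[OF sm[of "\<lambda>i. b (i + Suc n)"]]
      suminf_le[OF le[where b = "\<lambda>i. b (i + Suc n)"] sm[of "\<lambda>i. b (i + Suc n)"] sums_summable[OF geo]] sums_unique[OF geo]
    by (auto simp del: power_Suc)
  have "(\<Sum>i. of_bool (b i) / 3 ^ Suc i :: real) =
      (\<Sum>i. of_bool (b (i + Suc n)) / 3 ^ Suc (i + Suc n)) + (\<Sum>i<Suc n. of_bool (b i) / 3 ^ Suc i)"
    by (rule suminf_split_initial_segment[OF sm])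
  also have "(\<Sum>i. of_bool (b (i + Suc n)) / 3 ^ Suc (i + Suc n)) = r / 3 ^ Suc n"
    unfolding r_def suminf_divide[OF sm, symmetric] by (simp add: power_add field_simps)
  also have "(\<Sum>i<Suc n. of_bool (b i) / 3 ^ Suc i :: real) =
      of_int (of_bool (b n) + 3 * (\<Sum>i<n. of_bool (b i) * 3 ^ (n - Suc i))) / 3 ^ Suc n"
  proof -
    have "(\<Sum>i<n. of_bool (b i) / 3 ^ Suc i :: real) =
      (\<Sum>i<n. 3 * of_bool (b i) * 3 ^ (n - Suc i) / 3 ^ Suc n)"
    proof (rule sum.cong[OF refl])
      fix i assume "i \<in> {..<n}"
      then have "(3::real) ^ Suc n = 3 ^ Suc i * (3 * 3 ^ (n - Suc i))"
        by (simp flip: power_Suc power_add)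
      then show "of_bool (b i) / 3 ^ Suc i = 3 * of_bool (b i) * 3 ^ (n - Suc i) / (3::real) ^ Suc n"
        by (simp add: field_simps)
    qed
    then show ?thesis
      by (simp add: add_divide_distrib sum_divide_distrib sum_distrib_left mult.assoc del: sum_of_bool_mult_eq sum_mult_of_bool_eq)
  qed
  finally have "(\<Sum>i. of_bool (b i) / 3 ^ Suc i) * 3 ^ Suc n =
      r + of_int (of_bool (b n) + 3 * (\<Sum>i<n. of_bool (b i) * 3 ^ (n - Suc i)))"
    by (simp add: field_simps)
  then have "\<lfloor>(\<Sum>i. of_bool (b i) / 3 ^ Suc i) * 3 ^ Suc n :: real\<rfloor> =
      of_bool (b n) + 3 * (\<Sum>i<n. of_bool (b i) * 3 ^ (n - Suc i))"
    using r by (intro floor_unique) auto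
  then show ?thesis
    by (simp add: mod_add_eq flip: mod_mult_right_eq)
qed

text \<open>The code of \<open>y\<close> records, for all \<open>n\<close> and \<open>k\<close>,
  whether the dense point \<open>e k\<close> is within \<open>(1/2) ^ n\<close> of \<open>y\<close>.
  Decoding takes the first such \<open>k\<close> for each \<open>n\<close> and passes to the limit.
  On reals that code no point, \<open>LEAST\<close> and \<open>lim\<close> still give
  \<open>dec\<close> a value and keep it Borel.\<close>

lemma polish_real_code:
  obtains enc :: "'b::polish_space \<Rightarrow> real" and dec
  where "enc \<in> borel_measurable borel" "dec \<in> borel_measurable borel" "\<And>y. dec (enc y) = y"
proof -
  obtain e :: "nat \<Rightarrow> 'b" where e: "\<And>x r. 0 < r \<Longrightarrow> \<exists>i. dist x (e i) < r"
    using dense_sequence by blast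
  define bit where "bit y i = (case prod_decode i of (n, k) \<Rightarrow> dist y (e k) < (1/2) ^ n)" for y i
  define enc where "enc y = (\<Sum>i. of_bool (bit y i) / 3 ^ Suc i :: real)" for y
  define dig where "dig i r \<longleftrightarrow> \<lfloor>r * 3 ^ Suc i\<rfloor> mod 3 = 1" for i and r :: real
  define dec where "dec r = lim (\<lambda>n. e (LEAST k. dig (prod_encode (n, k)) r))" for r
  have dig_enc: "dig (prod_encode (n, k)) (enc y) \<longleftrightarrow> dist y (e k) < (1/2) ^ n" for n k y
    unfolding dig_def enc_def ternary_digit by (simp add: bit_def)
  have [measurable]: "Measurable.pred borel (\<lambda>y. bit y i)" for i
    unfolding bit_def by (cases "prod_decode i") simp
  have "enc \<in> borel_measurable borel"
    unfolding enc_def by measurable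
  moreover have [measurable]: "Measurable.pred borel (dig i)" for i
    unfolding dig_def by measurable
  have "dec \<in> borel_measurable borel"
    unfolding dec_def
  proof (rule borel_measurable_lim_polish)
    fix n
    have "(\<lambda>r. LEAST k. dig (prod_encode (n, k)) r) \<in> borel \<rightarrow>\<^sub>M count_space UNIV"
      by measurable
    then show "(\<lambda>r. e (LEAST k. dig (prod_encode (n, k)) r)) \<in> borel_measurable borel"
      by (rule measurable_compose) simp
  qed
  moreover have "dec (enc y) = y" for y
  proof -
    have "dist y (e (LEAST k. dig (prod_encode (n, k)) (enc y))) < (1/2) ^ n" for n
      unfolding dig_enc using e[of "(1/2) ^ n" y] by (auto intro: LeastI)
    then have "(\<lambda>n. dist (e (LEAST k. dig (prod_encode (n, k)) (enc y))) y) \<longlonglongrightarrow> 0"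
      by (intro real_tendsto_sandwich[OF _ _ tendsto_const LIMSEQ_power_zero[of "1/2"]])
        (auto simp: dist_commute intro: always_eventually less_imp_le)
    then show ?thesis
      unfolding dec_def by (intro limI) (rule tendsto_dist_iff[THEN iffD2])
  qed
  ultimately show thesis
    by (rule that)
qed

section \<open>Realising every law on the unit interval\<close>

abbreviation unit_lborel :: "real measure" where
  "unit_lborel \<equiv> restrict_space lborel {0<..<1}"

lemma prob_space_unit_lborel: "prob_space unit_lborel"
  by (auto simp: emeasure_restrict_space space_restrict_space intro!: prob_spaceI)

text \<open>Quantile transform: a law is pushed to the reals by \<open>enc\<close>, realised there
  on (0,1) by its quantile function, and pulled back by \<open>dec\<close>. No condition is put on
  \<open>F\<close>: a function that is no distribution function still gives a jointly measurable
  map, so the parameters fill the whole space \<open>rat \<Rightarrow> real\<close>.\<close>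

lemma law_code:
  obtains \<Theta> :: "(rat \<Rightarrow> real) \<Rightarrow> real \<Rightarrow> 'b::polish_space"
  where "(\<lambda>(F, \<omega>). \<Theta> F \<omega>) \<in> borel \<Otimes>\<^sub>M unit_lborel \<rightarrow>\<^sub>M borel"
    and "\<And>\<nu>. prob_space \<nu> \<Longrightarrow> sets \<nu> = sets borel \<Longrightarrow> \<exists>F. distr unit_lborel borel (\<Theta> F) = \<nu>"
proof -
  obtain enc :: "'b \<Rightarrow> real" and dec where
    [measurable]: "enc \<in> borel_measurable borel" "dec \<in> borel_measurable borel" and
    dec_enc: "\<And>y. dec (enc y) = y"
    using polish_real_code by blast
  \<comment> \<open>The quantile as an infimum over rational points, hence a countable one and
    jointly measurable. If no rational qualifies, the infimum is \<infinity>, which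
    \<open>real_of_ereal\<close> turns into 0.\<close>
  define Q where "Q F \<omega> = real_of_ereal (INF q::rat. if \<omega> \<le> F q then ereal (of_rat q) else \<infinity>)"
    for F :: "rat \<Rightarrow> real" and \<omega> :: real
  have Q: "(\<lambda>(F, \<omega>). Q F \<omega>) \<in> borel \<Otimes>\<^sub>M unit_lborel \<rightarrow>\<^sub>M borel"
  proof -
    have [measurable]: "(\<lambda>x. fst x q) \<in> borel_measurable (borel \<Otimes>\<^sub>M unit_lborel)" for q :: rat
      by (rule measurable_product_then_coordinatewise) simp
    have [measurable]: "snd \<in> borel_measurable (borel \<Otimes>\<^sub>M unit_lborel)"
      by (rule measurable_compose[OF measurable_snd]) (simp add: measurable_restrict_space1)
    show ?thesis
      unfolding Q_def split_beta' by measurable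
  qed
  have "\<exists>F. distr unit_lborel borel (\<lambda>\<omega>. dec (Q F \<omega>)) = \<nu>"
    if \<nu>: "prob_space \<nu>" and sets_\<nu> [measurable_cong]: "sets \<nu> = sets borel" for \<nu>
  proof -
    interpret \<nu>: prob_space \<nu> by fact
    define \<mu> where "\<mu> = distr \<nu> borel enc"
    interpret cdf_distribution \<mu>
      unfolding cdf_distribution_def \<mu>_def by (rule \<nu>.real_distribution_distr) measurable
    define F where "F q = cdf \<mu> (of_rat q)" for q
    have Q_eq: "Q F \<omega> = I \<omega>" if \<omega>: "\<omega> \<in> {0<..<1}" for \<omega>
    proof -
      define J where "J = I \<omega>"
      have iff: "\<omega> \<le> cdf \<mu> x \<longleftrightarrow> J \<le> x" for x
        unfolding J_def by (rule pseudoinverse) (use \<omega> in auto)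
      have "(INF q::rat. if \<omega> \<le> F q then ereal (of_rat q) else \<infinity>) = ereal J"
      proof (rule INF_eqI)
        fix q :: rat
        show "ereal J \<le> (if \<omega> \<le> F q then ereal (of_rat q) else \<infinity>)"
          by (simp add: F_def iff)
      next
        fix y assume y: "\<And>q::rat. q \<in> UNIV \<Longrightarrow> y \<le> (if \<omega> \<le> F q then ereal (of_rat q) else \<infinity>)"
        show "y \<le> ereal J"
        proof (rule ereal_le_epsilon2)
          fix \<epsilon> :: real assume "0 < \<epsilon>"
          then obtain q where q: "J < of_rat q" "of_rat q < J + \<epsilon>"
            using of_rat_dense[of J "J + \<epsilon>"] by auto
          then have "y \<le> ereal (of_rat q)"
            using y[of q] by (simp add: F_def iff split: if_splits)
          also have "\<dots> \<le> ereal J + ereal \<epsilon>"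
            using q by simp
          finally show "y \<le> ereal J + ereal \<epsilon>" .
        qed
      qed
      then show ?thesis by (simp add: Q_def flip: J_def)
    qed
    have [measurable]: "I \<in> borel_measurable unit_lborel"
      using measurable_CI by (simp cong: measurable_cong_sets sets_restrict_space_cong)
    have "distr unit_lborel borel (\<lambda>\<omega>. dec (Q F \<omega>)) = distr unit_lborel borel (\<lambda>\<omega>. dec (I \<omega>))"
      using Q_eq by (intro distr_cong) (auto simp: space_restrict_space)
    also have "\<dots> = distr (distr unit_lborel borel I) borel dec"
      by (simp add: distr_distr comp_def)
    also have "\<dots> = distr \<mu> borel dec"
      by (simp only: distr_I_eq_M)
    also have "\<dots> = distr \<nu> borel (\<lambda>y. y)"
      unfolding \<mu>_def by (subst distr_distr) (simp_all add: comp_def dec_enc)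
    also have "\<dots> = \<nu>"
      by (rule distr_id2) (simp add: sets_\<nu>)
    finally show ?thesis by blast
  qed
  moreover have "(\<lambda>(F, \<omega>). dec (Q F \<omega>)) \<in> borel \<Otimes>\<^sub>M unit_lborel \<rightarrow>\<^sub>M borel"
    using measurable_compose[OF Q, of dec borel] by (simp add: split_beta')
  ultimately show thesis
    by (intro that[of "\<lambda>F \<omega>. dec (Q F \<omega>)"])
qed

section \<open>Processes recovered from their values at rational times\<close>

text \<open>Rounding down keeps the grid point in the past of \<open>t\<close>, which makes the
  decoded process adapted. The mesh is \<open>1 / fact (K n)\<close>.\<close>

definition rat_approx :: "(nat \<Rightarrow> nat) \<Rightarrow> nat \<Rightarrow> real \<Rightarrow> rat" where
  "rat_approx K n t = of_int \<lfloor>t * fact (K n)\<rfloor> / fact (K n)"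

text \<open>One formula decodes every path: \<open>lim\<close> has a default value on divergent
  sequences, so the map is total and jointly measurable in \<open>K\<close>, \<open>y\<close> and
  \<open>t\<close>.\<close>

definition path_lim :: "(nat \<Rightarrow> nat) \<Rightarrow> (rat \<Rightarrow> 'a::polish_space) \<Rightarrow> real \<Rightarrow> 'a" where
  "path_lim K y t = lim (\<lambda>n. y (rat_approx K n t))"

text \<open>
  The past of the process up to time \<open>s\<close> is generated by the stopped path.
\<close>

definition stop_path :: "real \<Rightarrow> (rat \<Rightarrow> 'a) \<Rightarrow> rat \<Rightarrow> 'a" where
  "stop_path s y q = (if 0 \<le> q \<and> of_rat q \<le> s then y q else y 0)"

lemma of_rat_fact [simp]: "(of_rat (fact k) :: real) = fact k"
  by (metis of_rat_of_nat_eq of_nat_fact)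

lemma of_rat_rat_approx: "(of_rat (rat_approx K n t) :: real) = of_int \<lfloor>t * fact (K n)\<rfloor> / fact (K n)"
  by (simp add: rat_approx_def of_rat_divide)

lemma rat_approx_le: "of_rat (rat_approx K n t) \<le> t"
  unfolding of_rat_rat_approx by (simp add: pos_divide_le_eq)

lemma rat_approx_gt: "t - 1 / fact (K n) < of_rat (rat_approx K n t)"
proof -
  have "t * fact (K n) - 1 < of_int \<lfloor>t * fact (K n)\<rfloor>"
    by linarith
  then have "(t * fact (K n) - 1) / fact (K n) < of_int \<lfloor>t * fact (K n)\<rfloor> / (fact (K n) :: real)"
    by (rule divide_strict_right_mono) simp
  then show ?thesis
    unfolding of_rat_rat_approx by (simp add: diff_divide_distrib)
qed

lemma rat_approx_nonneg: "0 \<le> t \<Longrightarrow> 0 \<le> rat_approx K n t"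
  by (simp add: rat_approx_def)

lemma rat_approx_tendsto:
  assumes "\<And>n. n \<le> K n"
  shows "(\<lambda>n. of_rat (rat_approx K n t)) \<longlonglongrightarrow> t"
proof (rule real_tendsto_sandwich)
  have "1 / fact (K n) \<le> 1 / real n" if "n > 0" for n
  proof -
    have "n \<le> fact (K n)"
      using assms[of n] fact_ge_self[of "K n"] by linarith
    then have "real n \<le> real (fact (K n))"
      by (simp only: of_nat_le_iff)
    then show ?thesis
      using that by (intro divide_left_mono) auto
  qed
  then have "t - 1 / real n \<le> of_rat (rat_approx K n t)" if "1 \<le> n" for n
    using rat_approx_gt[of t K n] that by (smt (verit) less_le_trans zero_less_one)
  then show "eventually (\<lambda>n. t - 1 / real n \<le> of_rat (rat_approx K n t)) sequentially"
    by (rule eventually_sequentiallyI)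
  show "eventually (\<lambda>n. of_rat (rat_approx K n t) \<le> t) sequentially"
    by (simp add: rat_approx_le)
  show "(\<lambda>n. t - 1 / real n) \<longlonglongrightarrow> t"
    using tendsto_diff[OF tendsto_const lim_1_over_n[where 'a = real], of t] by simp
qed simp

text \<open>The factorials ensure that the approximations of a rational time are eventually exact.\<close>

lemma path_lim_rat:
  assumes "\<And>n. n \<le> K n"
  shows "path_lim K y (of_rat q) = y q"
proof -
  obtain a b :: int where q: "q = of_int a / of_int b" "0 < b"
    by (metis quotient_of_denom_pos quotient_of_div surj_pair)
  have "rat_approx K n (of_rat q) = q" if "nat b \<le> n" for n
  proof -
    have "nat b dvd fact (K n)"
      using q(2) that assms[of n] by (intro dvd_fact) auto
    then obtain c where c: "fact (K n) = nat b * c"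
      by (elim dvdE)
    have "(fact (K n) :: real) = of_int b * of_nat c" "(fact (K n) :: rat) = of_int b * of_nat c"
      using arg_cong[OF c, of real] arg_cong[OF c, of "of_nat :: nat \<Rightarrow> rat"] q(2) by auto
    moreover from this have "c \<noteq> 0"
      by (metis fact_nonzero mult_zero_right of_nat_0)
    ultimately have "(of_rat q :: real) * fact (K n) = of_int (a * int c)"
      using q(2) by (simp add: q(1) of_rat_divide)
    then have "rat_approx K n (of_rat q) = of_int (a * int c) / fact (K n)"
      unfolding rat_approx_def by (simp only: floor_of_int)
    also have "\<dots> = q"
      using q \<open>c \<noteq> 0\<close> \<open>(fact (K n) :: rat) = _\<close> by simp
    finally show ?thesis .
  qed
  then have "eventually (\<lambda>n. y (rat_approx K n (of_rat q)) = y q) sequentially"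
    by (auto intro: eventually_sequentiallyI[of "nat b"])
  then show ?thesis
    unfolding path_lim_def by (intro limI tendsto_eventually)
qed

lemma path_lim_stop_path:
  assumes "0 \<le> t" "t \<le> s"
  shows "path_lim K (stop_path s y) t = path_lim K y t"
proof -
  have "stop_path s y (rat_approx K n t) = y (rat_approx K n t)" for n
    using assms rat_approx_le[of K n t] rat_approx_nonneg[of t K n] by (simp add: stop_path_def)
  then show ?thesis
    by (simp add: path_lim_def)
qed

lemma stop_path_stop_path: "s \<le> t \<Longrightarrow> stop_path s (stop_path t y) = stop_path s y"
  by (auto simp: stop_path_def fun_eq_iff)

lemma measurable_path_apply:
  fixes y :: "'m \<Rightarrow> rat \<Rightarrow> 'a::polish_space"
  assumes "y \<in> borel_measurable M"
  shows "(\<lambda>x. y x q) \<in> borel_measurable M"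
  using assms by (rule measurable_product_then_coordinatewise)

lemma measurable_stop_path:
  fixes y :: "'m \<Rightarrow> rat \<Rightarrow> 'a::polish_space"
  assumes [measurable]: "y \<in> borel_measurable M"
  shows "(\<lambda>x. stop_path s (y x)) \<in> borel_measurable M"
proof (rule measurable_coordinatewise_then_product)
  fix q
  have [measurable]: "(\<lambda>x. y x r) \<in> borel_measurable M" for r
    by (rule measurable_path_apply) measurable
  show "(\<lambda>x. stop_path s (y x) q) \<in> borel_measurable M"
    unfolding stop_path_def by measurable
qed

text \<open>The rational index varies with \<open>x\<close> but takes only countably many values, so
  evaluating the path there is a countable case distinction.\<close>

lemma measurable_path_lim:
  fixes y :: "'m \<Rightarrow> rat \<Rightarrow> 'a::polish_space"
  assumes [measurable]: "\<And>n. (\<lambda>x. K x n) \<in> M \<rightarrow>\<^sub>M count_space UNIV" "y \<in> borel_measurable M"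
    "t \<in> borel_measurable M"
  shows "(\<lambda>x. path_lim (K x) (y x) (t x)) \<in> borel_measurable M"
  unfolding path_lim_def
proof (rule borel_measurable_lim_polish)
  fix n
  have [measurable]: "(\<lambda>x. y x r) \<in> borel_measurable M" for r
    by (rule measurable_path_apply) measurable
  have "(\<lambda>x. (\<lambda>i. of_int i / fact k :: rat) \<lfloor>t x * fact k\<rfloor>) \<in> M \<rightarrow>\<^sub>M count_space UNIV" for k
    by (rule measurable_compose[of _ _ "count_space UNIV"]) auto
  then have "(\<lambda>x. rat_approx (K x) n (t x)) \<in> M \<rightarrow>\<^sub>M count_space UNIV"
    unfolding rat_approx_def
    by (rule measurable_compose_countable[where g = "\<lambda>x. K x n"]) measurable
  then show "(\<lambda>x. y x (rat_approx (K x) n (t x))) \<in> borel_measurable M"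
    by (rule measurable_compose_countable[where g = "\<lambda>x. rat_approx (K x) n (t x)", rotated]) measurable
qed

section \<open>Almost sure convergence from summable expectations\<close>

lemma summable_dist_convergent:
  fixes u :: "nat \<Rightarrow> 'a::complete_space"
  assumes "summable (\<lambda>n. dist (u n) (u (Suc n)))"
  shows "convergent u"
proof (rule Cauchy_convergent, rule metric_CauchyI)
  fix e :: real assume "0 < e"
  then obtain N where N: "\<And>m n. N \<le> m \<Longrightarrow> norm (\<Sum>i\<in>{m..<n}. dist (u i) (u (Suc i))) < e / 2"
    using assms unfolding summable_Cauchy by (meson half_gt_zero)
  have sum_le: "dist (u N) (u (N + k)) \<le> (\<Sum>i\<in>{N..<N + k}. dist (u i) (u (Suc i)))" for k
  proof (induction k)
    case (Suc k)
    then show ?case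
      using dist_triangle[of "u N" "u (Suc (N + k))" "u (N + k)"] by simp
  qed simp
  have "dist (u N) (u m) < e / 2" if "N \<le> m" for m
    using sum_le[of "m - N"] N[of N m] that by simp
  then show "\<exists>M. \<forall>m\<ge>M. \<forall>n\<ge>M. dist (u m) (u n) < e"
    by (metis dist_triangle_half_r)
qed

text \<open>A Borel-Cantelli argument. Distances need not be integrable, so they are truncated at 1;
  a finite sum of truncated terms forces them below 1 from some index on, where truncation has no
  effect. The shift by \<open>n0\<close> drops the indices that carry no bound.\<close>

lemma (in prob_space) AE_summable_of_summable_expectation:
  fixes D :: "nat \<Rightarrow> 'a \<Rightarrow> real"
  assumes [measurable]: "\<And>n. D n \<in> borel_measurable M" and nonneg: "\<And>n \<omega>. 0 \<le> D n \<omega>"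
    and le: "\<And>n. n0 \<le> n \<Longrightarrow> expectation (\<lambda>\<omega>. min 1 (D n \<omega>)) \<le> (1/2) ^ n"
  shows "AE \<omega> in M. summable (\<lambda>n. D n \<omega>)"
proof -
  have int: "integrable M (\<lambda>\<omega>. min 1 (D n \<omega>))" for n
  proof (rule integrable_const_bound[of _ 1])
    have "norm (min 1 (D n \<omega>)) \<le> 1" for \<omega>
      using nonneg[of n \<omega>] by auto
    then show "AE \<omega> in M. norm (min 1 (D n \<omega>)) \<le> 1"
      by (intro AE_I2)
  qed measurable
  have "(\<integral>\<^sup>+\<omega>. (\<Sum>n. ennreal (min 1 (D (n + n0) \<omega>))) \<partial>M) =
      (\<Sum>n. \<integral>\<^sup>+\<omega>. ennreal (min 1 (D (n + n0) \<omega>)) \<partial>M)"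
    by (rule nn_integral_suminf) measurable
  also have "\<dots> = (\<Sum>n. ennreal (expectation (\<lambda>\<omega>. min 1 (D (n + n0) \<omega>))))"
    by (subst nn_integral_eq_integral) (simp_all add: int nonneg)
  also have "\<dots> \<le> (\<Sum>n. ennreal ((1/2) ^ n))"
  proof (intro suminf_le ennreal_leI summableI)
    fix n
    have "expectation (\<lambda>\<omega>. min 1 (D (n + n0) \<omega>)) \<le> (1/2) ^ (n + n0)"
      by (rule le) simp
    also have "\<dots> \<le> (1/2) ^ n"
      by (rule power_decreasing) auto
    finally show "expectation (\<lambda>\<omega>. min 1 (D (n + n0) \<omega>)) \<le> (1/2) ^ n" .
  qed
  also have "\<dots> = ennreal (\<Sum>n. (1/2) ^ n)"
    by (rule suminf_ennreal2) (auto intro: summable_geometric)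
  also have "\<dots> < \<infinity>"
    by simp
  finally have "AE \<omega> in M. (\<Sum>n. ennreal (min 1 (D (n + n0) \<omega>))) \<noteq> \<infinity>"
    by (intro nn_integral_noteq_infinite) auto
  then show ?thesis
  proof eventually_elim
    fix \<omega> assume "(\<Sum>n. ennreal (min 1 (D (n + n0) \<omega>))) \<noteq> \<infinity>"
    then have sm: "summable (\<lambda>n. min 1 (D (n + n0) \<omega>))"
      by (intro summable_suminf_not_top) (simp_all add: nonneg)
    then have "(\<lambda>n. min 1 (D (n + n0) \<omega>)) \<longlonglongrightarrow> 0"
      by (rule summable_LIMSEQ_zero)
    then have "eventually (\<lambda>n. min 1 (D (n + n0) \<omega>) < 1) sequentially"
      by (rule order_tendstoD) simp
    then have "eventually (\<lambda>n. min 1 (D (n + n0) \<omega>) = D (n + n0) \<omega>) sequentially"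
      by (rule eventually_mono) auto
    then have "summable (\<lambda>n. D (n + n0) \<omega>)"
      using sm by (rule summable_cong[THEN iffD1])
    then show "summable (\<lambda>n. D n \<omega>)"
      by (rule summable_iff_shift[THEN iffD1])
  qed
qed

section \<open>The process decoded from a path code\<close>

text \<open>The index \<open>n\<close> is both time horizon and precision: up to time
  \<open>n\<close>, rational times at distance at most \<open>1 / fact (K n)\<close> have values
  that are close up to \<open>(1/2) ^ n\<close>. These are countably many conditions, with bounds
  summable in \<open>n\<close>.\<close>

locale path_code = prob_space N
  for N :: "'w measure" +
  fixes K :: "nat \<Rightarrow> nat" and \<eta> :: "'w \<Rightarrow> rat \<Rightarrow> 'a::polish_space"
  assumes measurable_eta [measurable]: "\<eta> \<in> borel_measurable N"
    and K_incseq: "incseq K" and K_ge: "\<And>n. n \<le> K n"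
    and modulus: "\<And>n q q'. q \<in> {0..of_nat n} \<Longrightarrow> q' \<in> {0..of_nat n} \<Longrightarrow> \<bar>q - q'\<bar> \<le> 1 / fact (K n) \<Longrightarrow>
      expectation (\<lambda>\<omega>. min 1 (dist (\<eta> \<omega> q) (\<eta> \<omega> q'))) \<le> (1/2) ^ n"
begin

definition X :: "real \<Rightarrow> 'w \<Rightarrow> 'a" where
  "X t \<omega> = path_lim K (\<eta> \<omega>) t"

lemma X_of_rat: "X (of_rat q) \<omega> = \<eta> \<omega> q"
  unfolding X_def by (rule path_lim_rat[OF K_ge])

lemma X_stop_path: "0 \<le> u \<Longrightarrow> u \<le> s \<Longrightarrow> X u \<omega> = path_lim K (stop_path s (\<eta> \<omega>)) u"
  unfolding X_def by (simp add: path_lim_stop_path)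

lemma measurable_X_comp:
  assumes [measurable]: "t \<in> borel_measurable M" "w \<in> M \<rightarrow>\<^sub>M N"
  shows "(\<lambda>x. X (t x) (w x)) \<in> borel_measurable M"
  unfolding X_def by (rule measurable_path_lim) measurable

lemma measurable_X [measurable]: "X t \<in> borel_measurable N"
  by (rule measurable_X_comp) measurable

lemma measurable_process_X: "measurable_process N X"
  unfolding measurable_process_def split_beta'
proof (rule measurable_X_comp)
  have "(\<lambda>x. x) \<in> restrict_space borel {0..} \<rightarrow>\<^sub>M (borel :: real measure)"
    by (rule measurable_restrict_space1) simp
  from measurable_compose[OF measurable_fst this, of N]
  show "fst \<in> restrict_space borel {0..} \<Otimes>\<^sub>M N \<rightarrow>\<^sub>M (borel :: real measure)"
    by simp
qed measurable

lemma measurable_eta_apply [measurable]: "(\<lambda>\<omega>. \<eta> \<omega> q) \<in> borel_measurable N"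
  by (rule measurable_path_apply) measurable

text \<open>A pseudometric for convergence in probability, read as a function of the two
  times.\<close>

definition gap :: "real \<Rightarrow> real \<Rightarrow> real" where
  "gap s t = expectation (\<lambda>\<omega>. min 1 (dist (X s \<omega>) (X t \<omega>)))"

lemma gap_nonneg: "0 \<le> gap s t"
  unfolding gap_def by (intro integral_nonneg_AE) auto

lemma rat_approx_in:
  assumes "0 \<le> t" "t \<le> real n"
  shows "rat_approx K m t \<in> {0..of_nat n}"
proof -
  have "(of_rat (rat_approx K m t) :: real) \<le> of_rat (of_nat n)"
    using rat_approx_le[of K m t] assms by simp
  then show ?thesis
    using rat_approx_nonneg[OF assms(1)] by (simp only: of_rat_less_eq atLeastAtMost_iff simp_thms)
qed

text \<open>Consecutive grid points for \<open>t\<close> are at most \<open>1 / fact (K n)\<close>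
  apart because the meshes do not increase, so the modulus makes the distances between path values
  almost surely summable. The bound starts at \<open>n0\<close>, from where the horizon
  \<open>n\<close> covers \<open>t\<close>. The null set depends on \<open>t\<close>.\<close>

lemma AE_rat_approx_tendsto:
  assumes "0 \<le> t"
  shows "AE \<omega> in N. (\<lambda>n. \<eta> \<omega> (rat_approx K n t)) \<longlonglongrightarrow> X t \<omega>"
proof -
  obtain n0 where n0: "t \<le> real n0"
    using real_arch_simple by blast
  have "AE \<omega> in N. summable (\<lambda>n. dist (\<eta> \<omega> (rat_approx K n t)) (\<eta> \<omega> (rat_approx K (Suc n) t)))"
  proof (rule AE_summable_of_summable_expectation[where ?n0.0 = n0])
    fix n assume "n0 \<le> n"
    then have t: "t \<le> real n"
      using n0 by linarith
    have "(1::real) / fact (K (Suc n)) \<le> 1 / fact (K n)"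
      using K_incseq by (intro divide_left_mono fact_mono) (auto simp: incseq_SucD)
    then have "\<bar>of_rat (rat_approx K n t) - of_rat (rat_approx K (Suc n) t)\<bar> \<le> 1 / (fact (K n) :: real)"
      using rat_approx_le[of K n t] rat_approx_gt[of t K n]
        rat_approx_le[of K "Suc n" t] rat_approx_gt[of t K "Suc n"] by linarith
    then have "(of_rat \<bar>rat_approx K n t - rat_approx K (Suc n) t\<bar> :: real) \<le> of_rat (1 / fact (K n))"
      by (simp add: of_rat_divide of_rat_diff abs_if of_rat_minus split: if_splits)
    then have "\<bar>rat_approx K n t - rat_approx K (Suc n) t\<bar> \<le> 1 / fact (K n)"
      by (simp only: of_rat_less_eq)
    then show "expectation (\<lambda>\<omega>. min 1 (dist (\<eta> \<omega> (rat_approx K n t)) (\<eta> \<omega> (rat_approx K (Suc n) t)))) \<le> (1/2) ^ n"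
      by (intro modulus rat_approx_in assms t)
  qed auto
  then show ?thesis
  proof eventually_elim
    fix \<omega> assume "summable (\<lambda>n. dist (\<eta> \<omega> (rat_approx K n t)) (\<eta> \<omega> (rat_approx K (Suc n) t)))"
    then have "convergent (\<lambda>n. \<eta> \<omega> (rat_approx K n t))"
      by (rule summable_dist_convergent)
    then show "(\<lambda>n. \<eta> \<omega> (rat_approx K n t)) \<longlonglongrightarrow> X t \<omega>"
      unfolding X_def path_lim_def by (simp add: convergent_LIMSEQ_iff)
  qed
qed

lemma gap_le:
  assumes "0 \<le> s" "s \<le> real n" "0 \<le> t" "t \<le> real n" "\<bar>s - t\<bar> < 1 / fact (K n)"
  shows "gap s t \<le> (1/2) ^ n"
proof (rule LIMSEQ_le_const2)
  let ?Y = "\<lambda>m \<omega>. min 1 (dist (\<eta> \<omega> (rat_approx K m s)) (\<eta> \<omega> (rat_approx K m t)))"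
  show "(\<lambda>m. expectation (?Y m)) \<longlonglongrightarrow> gap s t"
    unfolding gap_def
  proof (rule integral_dominated_convergence[where w = "\<lambda>_. 1"])
    show "AE \<omega> in N. (\<lambda>m. ?Y m \<omega>) \<longlonglongrightarrow> min 1 (dist (X s \<omega>) (X t \<omega>))"
      using AE_rat_approx_tendsto[OF assms(1)] AE_rat_approx_tendsto[OF assms(3)]
      by eventually_elim (intro tendsto_intros)
  qed auto
  \<comment> \<open>The strict inequality between \<open>s\<close> and \<open>t\<close> passes to
    their rational approximations from some index on, where the modulus applies.\<close>
  have "(\<lambda>m. \<bar>of_rat (rat_approx K m s) - of_rat (rat_approx K m t)\<bar>) \<longlonglongrightarrow> \<bar>s - t\<bar>"
    by (intro tendsto_intros rat_approx_tendsto K_ge)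
  from order_tendstoD(2)[OF this assms(5)]
  have "eventually (\<lambda>m. expectation (?Y m) \<le> (1/2) ^ n) sequentially"
  proof eventually_elim
    fix m assume "\<bar>of_rat (rat_approx K m s) - of_rat (rat_approx K m t)\<bar> < 1 / (fact (K n) :: real)"
    then have "(of_rat \<bar>rat_approx K m s - rat_approx K m t\<bar> :: real) \<le> of_rat (1 / fact (K n))"
      by (simp add: of_rat_divide of_rat_diff abs_if of_rat_minus split: if_splits)
    then have "\<bar>rat_approx K m s - rat_approx K m t\<bar> \<le> 1 / fact (K n)"
      by (simp only: of_rat_less_eq)
    then show "expectation (?Y m) \<le> (1/2) ^ n"
      by (intro modulus rat_approx_in assms)
  qed
  then show "\<exists>M. \<forall>m\<ge>M. expectation (?Y m) \<le> (1/2) ^ n"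
    by (simp add: eventually_sequentially)
qed

lemma gap_tendsto:
  assumes "0 \<le> s" "\<And>k. 0 \<le> sk k" "sk \<longlonglongrightarrow> s"
  shows "(\<lambda>k. gap (sk k) s) \<longlonglongrightarrow> 0"
proof (rule order_tendstoI)
  fix r :: real assume "r < 0"
  then show "eventually (\<lambda>k. r < gap (sk k) s) sequentially"
    using gap_nonneg by (auto intro!: always_eventually intro: less_le_trans)
next
  fix r :: real assume "0 < r"
  then obtain n1 where n1: "(1/2) ^ n1 < r"
    using real_arch_pow_inv[of r "1/2"] by auto
  obtain n2 where n2: "s < real n2"
    using reals_Archimedean2 by blast
  define n where "n = max n1 n2"
  have n: "(1/2) ^ n < r" "s < real n"
    using n1 n2 power_decreasing[of n1 n "1/2::real"] unfolding n_def by linarith+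
  have "eventually (\<lambda>k. sk k < real n) sequentially"
    using assms(3) n(2) by (rule order_tendstoD)
  moreover have "eventually (\<lambda>k. \<bar>sk k - s\<bar> < 1 / fact (K n)) sequentially"
    using tendstoD[OF assms(3), of "1 / fact (K n)"] by (simp add: dist_real_def)
  ultimately show "eventually (\<lambda>k. gap (sk k) s < r) sequentially"
  proof eventually_elim
    fix k assume "sk k < real n" "\<bar>sk k - s\<bar> < 1 / fact (K n)"
    then have "gap (sk k) s \<le> (1/2) ^ n"
      using assms n by (intro gap_le) auto
    then show "gap (sk k) s < r"
      using n by simp
  qed
qed

lemma continuous_in_probability_X: "continuous_in_probability N X"
  unfolding continuous_in_probability_def
proof safe
  fix s and sk :: "nat \<Rightarrow> real" and \<epsilon> :: real
  assume s: "0 \<le> s" "\<forall>k. 0 \<le> sk k" "sk \<longlonglongrightarrow> s" and \<epsilon>: "0 < \<epsilon>"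
  \<comment> \<open>\<open>gap\<close> truncates distances at 1, so the level in Markov's inequality
    is lowered to at most 1.\<close>
  let ?c = "min 1 \<epsilon>"
  have le: "prob {\<omega> \<in> space N. \<epsilon> < dist (X (sk k) \<omega>) (X s \<omega>)} \<le> gap (sk k) s / ?c" for k
  proof -
    have "prob {\<omega> \<in> space N. \<epsilon> < dist (X (sk k) \<omega>) (X s \<omega>)} \<le>
        prob {\<omega> \<in> space N. ?c \<le> min 1 (dist (X (sk k) \<omega>) (X s \<omega>))}"
      by (intro finite_measure_mono) auto
    also have "\<dots> \<le> gap (sk k) s / ?c"
      unfolding gap_def using \<epsilon>
      by (intro integral_Markov_inequality_measure[where A = "space N"] integrable_const_bound[of _ 1]) auto
    finally show ?thesis .
  qed
  have lim: "(\<lambda>k. gap (sk k) s / ?c) \<longlonglongrightarrow> 0"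
    using tendsto_divide[OF gap_tendsto[of s sk] tendsto_const, of ?c] s \<epsilon> by simp
  show "(\<lambda>k. prob {\<omega> \<in> space N. \<epsilon> < dist (X (sk k) \<omega>) (X s \<omega>)}) \<longlonglongrightarrow> 0"
    by (rule tendsto_sandwich[OF _ _ tendsto_const lim]) (use le in \<open>auto intro: always_eventually\<close>)
qed

text \<open>Approximation from the right makes an event of the past of \<open>t\<close> also an
  event of the past of each approximating time. The bound \<open>t + 1\<close> gives a common
  horizon for dominated convergence.\<close>

lemma rat_right_approx:
  assumes "0 \<le> t"
  obtains q :: "nat \<Rightarrow> rat" where "\<And>n. t < of_rat (q n)" "\<And>n. of_rat (q n) \<le> t + 1"
    "(\<lambda>n. of_rat (q n)) \<longlonglongrightarrow> t" "AE \<omega> in N. (\<lambda>n. X (of_rat (q n)) \<omega>) \<longlonglongrightarrow> X t \<omega>"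
proof -
  \<comment> \<open>An index whose horizon reaches \<open>t + 1\<close> and whose precision is at
    least that of \<open>n\<close>.\<close>
  define m where "m n = n + nat \<lceil>t\<rceil> + 1" for n
  have m: "t + 1 \<le> real (m n)" "n \<le> m n" for n
    unfolding m_def using assms by linarith+
  have "\<exists>q. t < of_rat q \<and> of_rat q < t + min (1 / fact (K (m n))) (1 / Suc n)" for n
    by (rule of_rat_dense) simp
  then obtain q where q: "\<And>n. t < of_rat (q n)"
      "\<And>n. of_rat (q n) < t + min (1 / fact (K (m n))) (1 / Suc n)"
    by metis
  have le_1: "of_rat (q n) \<le> t + 1" for n
  proof -
    have "1 / real (Suc n) \<le> 1"
      by simp
    then show ?thesis
      using q(2)[of n] by linarith
  qed
  have lim: "(\<lambda>n. of_rat (q n)) \<longlonglongrightarrow> t"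
  proof (rule real_tendsto_sandwich)
    show "eventually (\<lambda>n. t \<le> of_rat (q n)) sequentially"
      using q(1) by (auto intro: always_eventually less_imp_le)
    have "of_rat (q n) \<le> t + 1 / Suc n" for n
      using q(2)[of n] by linarith
    then show "eventually (\<lambda>n. of_rat (q n) \<le> t + 1 / Suc n) sequentially"
      by (intro always_eventually allI)
    show "(\<lambda>n. t + 1 / Suc n) \<longlonglongrightarrow> t"
      using tendsto_add[OF tendsto_const LIMSEQ_inverse_real_of_nat, of t] by (simp add: inverse_eq_divide)
  qed simp
  have "gap (of_rat (q n)) t \<le> (1/2) ^ n" for n
  proof -
    have "gap (of_rat (q n)) t \<le> (1/2) ^ m n"
      using assms q[of n] m[of n] le_1[of n] by (intro gap_le) linarith+
    also have "\<dots> \<le> (1/2) ^ n"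
      using m by (intro power_decreasing) auto
    finally show ?thesis .
  qed
  then have "AE \<omega> in N. summable (\<lambda>n. dist (X (of_rat (q n)) \<omega>) (X t \<omega>))"
    unfolding gap_def by (intro AE_summable_of_summable_expectation[where ?n0.0 = 0]) auto
  then have "AE \<omega> in N. (\<lambda>n. X (of_rat (q n)) \<omega>) \<longlonglongrightarrow> X t \<omega>"
  proof eventually_elim
    fix \<omega> assume "summable (\<lambda>n. dist (X (of_rat (q n)) \<omega>) (X t \<omega>))"
    then show "(\<lambda>n. X (of_rat (q n)) \<omega>) \<longlonglongrightarrow> X t \<omega>"
      by (intro tendsto_dist_iff[THEN iffD2, OF summable_LIMSEQ_zero])
  qed
  with q(1) le_1 lim show thesis
    by (rule that)
qed

section \<open>The filtration of the decoded process\<close>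

definition past :: "real \<Rightarrow> 'w measure" where
  "past s = vimage_algebra (space N) (\<lambda>\<omega>. stop_path s (\<eta> \<omega>)) borel"

lemma space_past: "space (past s) = space N"
  by (simp add: past_def)

lemma measurable_stop_past [measurable]: "(\<lambda>\<omega>. stop_path s (\<eta> \<omega>)) \<in> borel_measurable (past s)"
  unfolding past_def by (rule measurable_vimage_algebra1) simp

lemma measurable_X_past:
  assumes "0 \<le> u" "u \<le> s"
  shows "X u \<in> borel_measurable (past s)"
proof -
  have "(\<lambda>\<omega>. path_lim K (stop_path s (\<eta> \<omega>)) u) \<in> borel_measurable (past s)"
    by (rule measurable_path_lim) measurable
  then show ?thesis
    using X_stop_path[OF assms] by (simp cong: measurable_cong)
qed

lemma measurable_integral_past:
  fixes h :: "'a \<Rightarrow> real"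
  assumes [measurable]: "h \<in> borel_measurable borel" and "0 \<le> u" "u \<le> s"
  shows "(\<lambda>\<omega>. LINT v:{0..u}|lborel. h (X v \<omega>)) \<in> borel_measurable (past s)"
proof -
  have [measurable]: "(\<lambda>p. path_lim K (stop_path s (\<eta> (fst p))) (snd p)) \<in> borel_measurable (past s \<Otimes>\<^sub>M lborel)"
    by (rule measurable_path_lim)
      (simp_all add: measurable_compose[OF measurable_fst measurable_stop_past])
  have "(\<lambda>\<omega>. LINT v:{0..u}|lborel. h (path_lim K (stop_path s (\<eta> \<omega>)) v)) \<in> borel_measurable (past s)"
    unfolding set_lebesgue_integral_def
    by (rule lborel.borel_measurable_lebesgue_integral) (unfold split_beta', measurable)
  moreover have "(LINT v:{0..u}|lborel. h (path_lim K (stop_path s (\<eta> \<omega>)) v)) =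
      (LINT v:{0..u}|lborel. h (X v \<omega>))" for \<omega>
    using assms(3) by (intro set_lebesgue_integral_cong) (auto simp: X_stop_path[of _ s])
  ultimately show ?thesis
    by simp
qed

text \<open>Every generator of the filtration, the time integrals included, is a function of the
  stopped path, because \<open>path_lim\<close> rounds down. Conversely the path at rational times
  is the process itself. A single random element thus generates the past, and all test events are
  preimages under it.\<close>

lemma sets_star_filtration:
  assumes "0 \<le> s"
  shows "sets (star_filtration N X s) = sets (past s)"
proof
  let ?G = "{X u -` B \<inter> space N | u B. 0 \<le> u \<and> u \<le> s \<and> B \<in> sets borel} \<union>
      {(\<lambda>\<omega>. LINT v:{0..u}|lborel. h (X v \<omega>)) -` B \<inter> space N | u h B.
         0 \<le> u \<and> u \<le> s \<and> h \<in> Cb \<and> B \<in> sets borel}"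
  have sets_eq: "sets (star_filtration N X s) = sigma_sets (space N) ?G"
    unfolding star_filtration_def by (rule sets_measure_of) auto
  have space_eq: "space (star_filtration N X s) = space N"
    unfolding star_filtration_def by (rule space_measure_of) auto
  have "?G \<subseteq> sets (past s)"
  proof safe
    fix u :: real and B :: "'a set" assume "0 \<le> u" "u \<le> s" "B \<in> sets borel"
    then show "X u -` B \<inter> space N \<in> sets (past s)"
      using measurable_sets[OF measurable_X_past, of u s B] by (simp add: space_past)
  next
    fix u :: real and h :: "'a \<Rightarrow> real" and B :: "real set"
    assume "0 \<le> u" "u \<le> s" "h \<in> Cb" "B \<in> sets borel"
    moreover from this have "h \<in> borel_measurable borel"
      unfolding Cb_def by (auto intro: borel_measurable_continuous_onI)
    ultimately show "(\<lambda>\<omega>. LINT v:{0..u}|lborel. h (X v \<omega>)) -` B \<inter> space N \<in> sets (past s)"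
      using measurable_sets[OF measurable_integral_past, of h u s B] by (simp add: space_past)
  qed
  then show "sets (star_filtration N X s) \<subseteq> sets (past s)"
    unfolding sets_eq using sets.sigma_sets_subset[of ?G "past s"] by (simp add: space_past)
  have X_star: "X u \<in> borel_measurable (star_filtration N X s)" if "0 \<le> u" "u \<le> s" for u
  proof (rule measurableI)
    fix B :: "'a set" assume "B \<in> sets borel"
    with that show "X u -` B \<inter> space (star_filtration N X s) \<in> sets (star_filtration N X s)"
      unfolding sets_eq space_eq by (intro sigma_sets.Basic) blast
  qed simp
  have eta_star: "(\<lambda>\<omega>. \<eta> \<omega> q) \<in> borel_measurable (star_filtration N X s)" if "0 \<le> q" "of_rat q \<le> s" for q
    using X_star[of "of_rat q"] that unfolding X_of_rat[abs_def] by simp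
  have "(\<lambda>\<omega>. stop_path s (\<eta> \<omega>)) \<in> borel_measurable (star_filtration N X s)"
  proof (rule measurable_coordinatewise_then_product)
    show "(\<lambda>\<omega>. stop_path s (\<eta> \<omega>) q) \<in> borel_measurable (star_filtration N X s)" for q
      using eta_star[of q] eta_star[of 0] assms by (cases "0 \<le> q \<and> of_rat q \<le> s") (auto simp: stop_path_def)
  qed
  then show "sets (past s) \<subseteq> sets (star_filtration N X s)"
    unfolding past_def by (rule sets_image_in_sets[OF space_eq])
qed

lemma space_star_filtration: "space (star_filtration N X s) = space N"
  unfolding star_filtration_def by (rule space_measure_of) auto

end

section \<open>The martingale property from countably many tests\<close>

text \<open>The generator consists of the finite intersections of a countable basis;
  \<open>UNIV\<close> is the empty intersection.\<close>

lemma second_countable_generator: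
  obtains B :: "nat \<Rightarrow> 'b::second_countable_topology set"
  where "Int_stable (range B)" "UNIV \<in> range B" "sets borel = sigma_sets UNIV (range B)"
proof -
  obtain \<B> :: "'b set set" where \<B>: "countable \<B>" "topological_basis \<B>"
    using ex_countable_basis by blast
  define \<C> where "\<C> = Inter ` {F. finite F \<and> F \<subseteq> \<B>}"
  have "countable \<C>"
    unfolding \<C>_def using \<B>(1) by (intro countable_image countable_Collect_finite_subset)
  have UNIV: "UNIV \<in> \<C>"
    unfolding \<C>_def by (intro image_eqI[of _ _ "{}"]) auto
  have "Int_stable \<C>"
  proof (rule Int_stableI)
    fix a b assume "a \<in> \<C>" "b \<in> \<C>"
    then obtain F G where "a = \<Inter>F" "b = \<Inter>G" "finite F" "F \<subseteq> \<B>" "finite G" "G \<subseteq> \<B>"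
      unfolding \<C>_def by blast
    then show "a \<inter> b \<in> \<C>"
      unfolding \<C>_def by (intro image_eqI[of _ _ "F \<union> G"]) (auto simp: Inter_Un_distrib)
  qed
  have "\<B> \<subseteq> \<C>"
  proof
    fix b assume "b \<in> \<B>"
    then show "b \<in> \<C>"
      unfolding \<C>_def by (intro image_eqI[of _ _ "{b}"]) auto
  qed
  moreover have "open b" if "b \<in> \<C>" for b
    using that topological_basis_open[OF \<B>(2)] unfolding \<C>_def by (auto intro: open_Inter)
  ultimately have "topological_basis \<C>"
    using \<B>(2) unfolding topological_basis_def by (meson subset_trans)
  then have "sets borel = sigma_sets UNIV \<C>"
    using borel_eq_countable_basis[OF \<open>countable \<C>\<close>] by (metis sets_measure_of top_greatest Pow_UNIV)
  moreover have "range (from_nat_into \<C>) = \<C>"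
    using UNIV \<open>countable \<C>\<close> by (intro range_from_nat_into) auto
  ultimately show thesis
    using \<open>Int_stable \<C>\<close> UNIV by (intro that[of "from_nat_into \<C>"]) simp_all
qed

text \<open>A Dynkin argument for a signed integrand: \<open>UNIV \<in> G\<close> makes the total
  integral vanish, which gives complements, and \<open>norm (Z \<omega>)\<close> dominates the
  partial unions.\<close>

lemma (in prob_space) expectation_indicator_zero:
  fixes T :: "'a \<Rightarrow> 'b::topological_space" and Z :: "'a \<Rightarrow> real"
  assumes T [measurable]: "T \<in> borel_measurable M" and Z: "integrable M Z"
    and G: "Int_stable G" "UNIV \<in> G" "sets borel = sigma_sets UNIV G"
    and zero: "\<And>A. A \<in> G \<Longrightarrow> expectation (\<lambda>\<omega>. indicator A (T \<omega>) * Z \<omega>) = 0"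
    and A: "A \<in> sets borel"
  shows "expectation (\<lambda>\<omega>. indicator A (T \<omega>) * Z \<omega>) = 0"
proof -
  have [measurable]: "Z \<in> borel_measurable M"
    using Z by auto
  have bound: "norm (indicator A (T \<omega>) * Z \<omega>) \<le> norm (Z \<omega>)" for A :: "'b set" and \<omega>
    by (simp add: indicator_def)
  have int: "integrable M (\<lambda>\<omega>. indicator A (T \<omega>) * Z \<omega>)" if [measurable]: "A \<in> sets borel" for A
    by (rule Bochner_Integration.integrable_bound[OF Z]) (use bound in auto)
  have Z_zero: "expectation Z = 0"
    using zero[OF G(2)] by simp
  show ?thesis
  proof (rule sigma_sets_induct_disjoint[OF G(1), of UNIV])
    show "A \<in> sigma_sets UNIV G"
      using A G(3) by simp
  next
    fix A assume "A \<in> sigma_sets UNIV G" and IH: "expectation (\<lambda>\<omega>. indicator A (T \<omega>) * Z \<omega>) = 0"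
    then have A: "A \<in> sets borel"
      using G(3) by simp
    have "expectation (\<lambda>\<omega>. indicator (UNIV - A) (T \<omega>) * Z \<omega>) =
        expectation (\<lambda>\<omega>. Z \<omega> - indicator A (T \<omega>) * Z \<omega>)"
      by (intro Bochner_Integration.integral_cong) (auto simp: indicator_def)
    also have "\<dots> = 0"
      using Z_zero IH by (subst Bochner_Integration.integral_diff[OF Z int[OF A]]) simp
    finally show "expectation (\<lambda>\<omega>. indicator (UNIV - A) (T \<omega>) * Z \<omega>) = 0" .
  next
    fix A :: "nat \<Rightarrow> 'b set"
    assume disj: "disjoint_family A" and "range A \<subseteq> sigma_sets UNIV G"
      and IH: "\<And>i. expectation (\<lambda>\<omega>. indicator (A i) (T \<omega>) * Z \<omega>) = 0"
    then have A [measurable]: "A i \<in> sets borel" for i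
      using G(3) by auto
    have "(\<lambda>n. expectation (\<lambda>\<omega>. indicator (\<Union>i<n. A i) (T \<omega>) * Z \<omega>)) \<longlonglongrightarrow>
        expectation (\<lambda>\<omega>. indicator (\<Union>i. A i) (T \<omega>) * Z \<omega>)"
    proof (rule integral_dominated_convergence[where w = "\<lambda>\<omega>. norm (Z \<omega>)"])
      show "AE \<omega> in M. (\<lambda>n. indicator (\<Union>i<n. A i) (T \<omega>) * Z \<omega>) \<longlonglongrightarrow>
          indicator (\<Union>i. A i) (T \<omega>) * Z \<omega>"
        by (intro AE_I2 tendsto_mult tendsto_const LIMSEQ_indicator_UN)
      show "AE \<omega> in M. norm (indicator (\<Union>i<n. A i) (T \<omega>) * Z \<omega>) \<le> norm (Z \<omega>)" for n
        using bound by (intro AE_I2)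
      show "integrable M (\<lambda>\<omega>. norm (Z \<omega>))"
        using Z by simp
    qed (intro borel_measurable_integrable int sets.countable_UN sets.finite_UN; use A in auto)+
    moreover have "expectation (\<lambda>\<omega>. indicator (\<Union>i<n. A i) (T \<omega>) * Z \<omega>) = 0" for n
    proof -
      have disj_n: "disjoint_family_on A {..<n}"
        using disj by (rule disjoint_family_on_mono[rotated]) simp
      have "expectation (\<lambda>\<omega>. indicator (\<Union>i<n. A i) (T \<omega>) * Z \<omega>) =
          expectation (\<lambda>\<omega>. \<Sum>i<n. indicator (A i) (T \<omega>) * Z \<omega>)"
        by (simp add: indicator_UN_disjoint[OF _ disj_n] sum_distrib_right)
      also have "\<dots> = 0"
        by (subst Bochner_Integration.integral_sum) (simp_all add: int IH)
      finally show ?thesis .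
    qed
    ultimately show "expectation (\<lambda>\<omega>. indicator (\<Union>i. A i) (T \<omega>) * Z \<omega>) = 0"
      by (simp add: LIMSEQ_const_iff)
  qed (simp_all add: zero)
qed

lemma set_integral_upper_limit_tendsto:
  fixes h :: "real \<Rightarrow> real"
  assumes h: "set_integrable lborel {0..T} h" and u: "\<And>n. u n \<le> T" "u \<longlonglongrightarrow> t"
  shows "(\<lambda>n. LINT s:{0..u n}|lborel. h s) \<longlonglongrightarrow> (LINT s:{0..t}|lborel. h s)"
proof -
  have tT: "t \<le> T"
    using u by (meson LIMSEQ_le_const2)
  have meas: "(\<lambda>s. indicator {0..T} s * h s) \<in> borel_measurable lborel"
    using h unfolding set_integrable_def by auto
  have eq: "(\<lambda>s. indicator {0..v} s *\<^sub>R h s) = (\<lambda>s. indicator {0..v} s * (indicator {0..T} s * h s))" if "v \<le> T" for v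
    using that by (auto simp: indicator_def fun_eq_iff)
  show ?thesis
    unfolding set_lebesgue_integral_def eq[OF u(1)] eq[OF tT]
  proof (rule integral_dominated_convergence[where w = "\<lambda>s. norm (indicator {0..T} s * h s)"])
    show "integrable lborel (\<lambda>s. norm (indicator {0..T} s * h s))"
      using h unfolding set_integrable_def by (auto intro: integrable_norm)
    \<comment> \<open>The end point \<open>s = t\<close> is the only time at which the indicators
      can fail to converge.\<close>
    have "AE s in lborel. s \<noteq> t"
      by (rule AE_lborel_singleton)
    then show "AE s in lborel. (\<lambda>n. indicator {0..u n} s * (indicator {0..T} s * h s)) \<longlonglongrightarrow>
        indicator {0..t} s * (indicator {0..T} s * h s)"
    proof eventually_elim
      fix s :: real assume "s \<noteq> t"
      have "eventually (\<lambda>n. (indicator {0..u n} s :: real) = indicator {0..t} s) sequentially"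
      proof (cases "s < t")
        case True
        from order_tendstoD(1)[OF u(2) this] show ?thesis
          by eventually_elim (use True in \<open>auto simp: indicator_def\<close>)
      next
        case False
        with \<open>s \<noteq> t\<close> have "t < s"
          by simp
        from order_tendstoD(2)[OF u(2) this] show ?thesis
          by eventually_elim (use \<open>t < s\<close> in \<open>auto simp: indicator_def\<close>)
      qed
      then show "(\<lambda>n. indicator {0..u n} s * (indicator {0..T} s * h s)) \<longlonglongrightarrow>
          indicator {0..t} s * (indicator {0..T} s * h s)"
        by (intro tendsto_mult tendsto_const tendsto_eventually)
    qed
    show "AE s in lborel. norm (indicator {0..u n} s * (indicator {0..T} s * h s)) \<le>
        norm (indicator {0..T} s * h s)" for n
      by (intro AE_I2) (auto simp: indicator_def)
  qed (use meas in measurable)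
qed

section \<open>Integrability and domination\<close>

text \<open>Integer horizons give all real ones by monotonicity and keep the integrability condition
  countable.\<close>

locale integrable_path_code = path_code N K \<eta>
  for N :: "'w measure" and K and \<eta> :: "'w \<Rightarrow> rat \<Rightarrow> 'a::polish_space" +
  fixes \<Phi> :: "'a \<Rightarrow> real"
  assumes Phi_measurable [measurable]: "\<Phi> \<in> borel_measurable borel"
    and Phi_nonneg: "\<And>x. 0 \<le> \<Phi> x"
    and Phi_integral: "\<And>n::nat. (\<integral>\<^sup>+\<omega>. (\<integral>\<^sup>+s\<in>{0..real n}. ennreal (\<Phi> (X s \<omega>)) \<partial>lborel) \<partial>N) < \<infinity>"
begin

definition total :: "real \<Rightarrow> 'w \<Rightarrow> real" where
  "total T \<omega> = (LINT s:{0..T}|lborel. \<Phi> (X s \<omega>))"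

definition mart :: "('a \<Rightarrow> real) \<Rightarrow> ('a \<Rightarrow> real) \<Rightarrow> real \<Rightarrow> 'w \<Rightarrow> real" where
  "mart f g t \<omega> = f (X t \<omega>) - (LINT s:{0..t}|lborel. g (X s \<omega>))"

lemma measurable_X_swap [measurable]: "(\<lambda>p. X (snd p) (fst p)) \<in> N \<Otimes>\<^sub>M lborel \<rightarrow>\<^sub>M borel"
  by (rule measurable_X_comp) measurable

lemma measurable_X_time [measurable]: "\<omega> \<in> space N \<Longrightarrow> (\<lambda>s. X s \<omega>) \<in> borel_measurable lborel"
  by (rule measurable_X_comp) measurable

lemma measurable_integral [measurable]:
  fixes h :: "'a \<Rightarrow> real"
  assumes [measurable]: "h \<in> borel_measurable borel"
  shows "(\<lambda>\<omega>. LINT s:{0..t}|lborel. h (X s \<omega>)) \<in> borel_measurable N"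
  unfolding set_lebesgue_integral_def
  by (rule lborel.borel_measurable_lebesgue_integral) (unfold split_beta', measurable)

lemma measurable_mart:
  assumes [measurable]: "f \<in> borel_measurable borel" "g \<in> borel_measurable borel"
  shows "mart f g t \<in> borel_measurable N"
  unfolding mart_def by measurable

lemma Phi_integral_real:
  "(\<integral>\<^sup>+\<omega>. (\<integral>\<^sup>+s\<in>{0..T}. ennreal (\<Phi> (X s \<omega>)) \<partial>lborel) \<partial>N) < \<infinity>"
proof -
  obtain n where n: "T \<le> real n"
    using real_arch_simple by blast
  have "(\<integral>\<^sup>+\<omega>. (\<integral>\<^sup>+s\<in>{0..T}. ennreal (\<Phi> (X s \<omega>)) \<partial>lborel) \<partial>N) \<le>
      (\<integral>\<^sup>+\<omega>. (\<integral>\<^sup>+s\<in>{0..real n}. ennreal (\<Phi> (X s \<omega>)) \<partial>lborel) \<partial>N)"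
    using n by (intro nn_integral_mono) (auto simp: indicator_def)
  then show ?thesis
    using Phi_integral[of n] by (rule le_less_trans)
qed

lemma measurable_nn_integral_Phi [measurable]:
  "(\<lambda>\<omega>. \<integral>\<^sup>+s\<in>{0..T}. ennreal (\<Phi> (X s \<omega>)) \<partial>lborel) \<in> borel_measurable N"
  by (rule lborel.borel_measurable_nn_integral) (unfold split_beta', measurable)

lemma AE_set_integrable_Phi: "AE \<omega> in N. set_integrable lborel {0..T} (\<lambda>s. \<Phi> (X s \<omega>))"
proof -
  have "AE \<omega> in N. (\<integral>\<^sup>+s\<in>{0..T}. ennreal (\<Phi> (X s \<omega>)) \<partial>lborel) \<noteq> \<infinity>"
    by (rule nn_integral_noteq_infinite) (use Phi_integral_real[of T] in auto)
  then show ?thesis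
  proof (rule AE_mp, intro AE_I2 impI)
    fix \<omega> assume [measurable]: "\<omega> \<in> space N" and fin: "(\<integral>\<^sup>+s\<in>{0..T}. ennreal (\<Phi> (X s \<omega>)) \<partial>lborel) \<noteq> \<infinity>"
    have "(\<integral>\<^sup>+s. ennreal (norm (indicator {0..T} s *\<^sub>R \<Phi> (X s \<omega>))) \<partial>lborel) =
        (\<integral>\<^sup>+s\<in>{0..T}. ennreal (\<Phi> (X s \<omega>)) \<partial>lborel)"
      by (intro nn_integral_cong) (auto simp: indicator_def Phi_nonneg)
    then show "set_integrable lborel {0..T} (\<lambda>s. \<Phi> (X s \<omega>))"
      unfolding set_integrable_def using fin by (intro integrableI_bounded) (auto simp: top.not_eq_extremum)
  qed
qed

lemma integrable_total: "integrable N (total T)"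
proof (rule integrableI_bounded)
  show "total T \<in> borel_measurable N"
    unfolding total_def by measurable
  have "(\<integral>\<^sup>+\<omega>. ennreal (norm (total T \<omega>)) \<partial>N) =
      (\<integral>\<^sup>+\<omega>. (\<integral>\<^sup>+s\<in>{0..T}. ennreal (\<Phi> (X s \<omega>)) \<partial>lborel) \<partial>N)"
  proof (rule nn_integral_cong_AE)
    show "AE \<omega> in N. ennreal (norm (total T \<omega>)) = (\<integral>\<^sup>+s\<in>{0..T}. ennreal (\<Phi> (X s \<omega>)) \<partial>lborel)"
      using AE_set_integrable_Phi[of T]
    proof eventually_elim
      fix \<omega> assume "set_integrable lborel {0..T} (\<lambda>s. \<Phi> (X s \<omega>))"
      then have "(\<integral>\<^sup>+s. ennreal (indicator {0..T} s *\<^sub>R \<Phi> (X s \<omega>)) \<partial>lborel) = ennreal (total T \<omega>)"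
        unfolding set_integrable_def total_def set_lebesgue_integral_def
        by (intro nn_integral_eq_integral) (auto simp: Phi_nonneg)
      moreover have "0 \<le> total T \<omega>"
        unfolding total_def set_lebesgue_integral_def by (intro integral_nonneg_AE) (auto simp: Phi_nonneg)
      moreover have "(\<integral>\<^sup>+s. ennreal (indicator {0..T} s *\<^sub>R \<Phi> (X s \<omega>)) \<partial>lborel) =
          (\<integral>\<^sup>+s\<in>{0..T}. ennreal (\<Phi> (X s \<omega>)) \<partial>lborel)"
        by (intro nn_integral_cong) (auto simp: indicator_def)
      ultimately show "ennreal (norm (total T \<omega>)) = (\<integral>\<^sup>+s\<in>{0..T}. ennreal (\<Phi> (X s \<omega>)) \<partial>lborel)"
        by simp
    qed
  qed
  then show "(\<integral>\<^sup>+\<omega>. ennreal (norm (total T \<omega>)) \<partial>N) < \<infinity>"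
    using Phi_integral_real[of T] by simp
qed

lemma set_integrable_dominated:
  assumes [measurable]: "g \<in> borel_measurable borel" and g: "\<And>x. \<bar>g x\<bar> \<le> C * \<Phi> x"
    and \<omega>: "\<omega> \<in> space N" "set_integrable lborel {0..T} (\<lambda>s. \<Phi> (X s \<omega>))" and t: "t \<le> T"
  shows "set_integrable lborel {0..t} (\<lambda>s. g (X s \<omega>))"
proof (rule set_integrable_subset)
  show "set_integrable lborel {0..T} (\<lambda>s. g (X s \<omega>))"
  proof (rule set_integrable_bound)
    show "set_integrable lborel {0..T} (\<lambda>s. C * \<Phi> (X s \<omega>))"
      using \<omega>(2) by (rule set_integrable_mult_right)
    show "set_borel_measurable lborel {0..T} (\<lambda>s. g (X s \<omega>))"
      unfolding set_borel_measurable_def using \<omega>(1) by measurable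
    show "AE s in lborel. s \<in> {0..T} \<longrightarrow> norm (g (X s \<omega>)) \<le> norm (C * \<Phi> (X s \<omega>))"
      using g by (intro AE_I2) (auto intro: order_trans[OF _ abs_ge_self])
  qed
qed (use t in auto)

lemma mart_bound:
  assumes [measurable]: "g \<in> borel_measurable borel"
    and f: "\<And>x. \<bar>f x\<bar> \<le> C" and g: "\<And>x. \<bar>g x\<bar> \<le> C * \<Phi> x"
    and \<omega>: "\<omega> \<in> space N" "set_integrable lborel {0..T} (\<lambda>s. \<Phi> (X s \<omega>))" and t: "0 \<le> t" "t \<le> T"
  shows "\<bar>mart f g t \<omega>\<bar> \<le> C + C * total T \<omega>"
proof -
  have C: "0 \<le> C"
    using f[of undefined] by linarith
  have "\<bar>LINT s:{0..t}|lborel. g (X s \<omega>)\<bar> \<le> (LINT s:{0..t}|lborel. \<bar>g (X s \<omega>)\<bar>)"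
    using set_integral_norm_bound[OF set_integrable_dominated[OF assms(1) g \<omega> t(2)]] by simp
  also have "\<dots> \<le> (LINT s:{0..T}|lborel. C * \<Phi> (X s \<omega>))"
    unfolding set_lebesgue_integral_def
  proof (rule integral_mono)
    show "integrable lborel (\<lambda>s. indicator {0..t} s *\<^sub>R \<bar>g (X s \<omega>)\<bar>)"
      using set_integrable_abs[OF set_integrable_dominated[OF assms(1) g \<omega> t(2)]] unfolding set_integrable_def .
    show "integrable lborel (\<lambda>s. indicator {0..T} s *\<^sub>R (C * \<Phi> (X s \<omega>)))"
      using set_integrable_mult_right[OF \<omega>(2), of C] unfolding set_integrable_def .
    show "indicator {0..t} s *\<^sub>R \<bar>g (X s \<omega>)\<bar> \<le> indicator {0..T} s *\<^sub>R (C * \<Phi> (X s \<omega>))" for s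
      using g[of "X s \<omega>"] t C Phi_nonneg by (auto simp: indicator_def)
  qed
  also have "\<dots> = C * total T \<omega>"
    unfolding total_def by simp
  finally show ?thesis
    unfolding mart_def using f[of "X t \<omega>"] by linarith
qed

text \<open>The exceptional null set comes from the integrability of \<Phi> up to the horizon alone,
  so a single one serves all times in \<open>{0..T}\<close>.\<close>

lemma AE_mart_bound:
  assumes "g \<in> borel_measurable borel" "\<And>x. \<bar>f x\<bar> \<le> C" "\<And>x. \<bar>g x\<bar> \<le> C * \<Phi> x"
  shows "AE \<omega> in N. \<forall>t\<in>{0..T}. \<bar>mart f g t \<omega>\<bar> \<le> C + C * total T \<omega>"
  using AE_set_integrable_Phi[of T]
  by (rule AE_mp) (intro AE_I2 impI ballI mart_bound assms, auto)

lemma integrable_dominating: "integrable N (\<lambda>\<omega>. C + C * total T \<omega>)"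
  by (intro Bochner_Integration.integrable_add integrable_mult_right integrable_total) simp

lemma integrable_mart:
  assumes "f \<in> borel_measurable borel" "g \<in> borel_measurable borel"
    "\<And>x. \<bar>f x\<bar> \<le> C" "\<And>x. \<bar>g x\<bar> \<le> C * \<Phi> x" "0 \<le> t"
  shows "integrable N (mart f g t)"
proof (rule Bochner_Integration.integrable_bound[OF integrable_dominating[of C t]])
  show "mart f g t \<in> borel_measurable N"
    using assms by (intro measurable_mart)
  show "AE \<omega> in N. norm (mart f g t \<omega>) \<le> norm (C + C * total t \<omega>)"
    using AE_mart_bound[OF assms(2-4), of t]
  proof eventually_elim
    fix \<omega> assume "\<forall>r\<in>{0..t}. \<bar>mart f g r \<omega>\<bar> \<le> C + C * total t \<omega>"
    with assms(5) have "\<bar>mart f g t \<omega>\<bar> \<le> C + C * total t \<omega>"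
      by simp
    then show "norm (mart f g t \<omega>) \<le> norm (C + C * total t \<omega>)"
      by simp
  qed
qed

end

section \<open>Passing to the limit in the test identities\<close>

context integrable_path_code
begin

text \<open>The time \<open>r\<close> of the test event is kept apart from the end points
  \<open>s\<close> and \<open>t\<close>, so that the event can stay fixed while they move.\<close>

abbreviation increment :: "(rat \<Rightarrow> 'a) set \<Rightarrow> ('a \<Rightarrow> real) \<Rightarrow> ('a \<Rightarrow> real) \<Rightarrow> real \<Rightarrow> real \<Rightarrow> real \<Rightarrow> real" where
  "increment A f g r s t \<equiv>
    expectation (\<lambda>\<omega>. indicator A (stop_path r (\<eta> \<omega>)) * (mart f g t \<omega> - mart f g s \<omega>))"

text \<open>One dominated convergence covers both limits taken later: moving times with fixed
  functions, and moving functions with fixed times.\<close>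

lemma increment_tendsto:
  fixes f g :: "nat \<Rightarrow> 'a \<Rightarrow> real" and s t :: "nat \<Rightarrow> real"
  assumes A: "A \<in> sets borel"
    and meas: "\<And>n. f n \<in> borel_measurable borel" "\<And>n. g n \<in> borel_measurable borel"
      "f' \<in> borel_measurable borel" "g' \<in> borel_measurable borel"
    and bound: "\<And>n x. \<bar>f n x\<bar> \<le> C" "\<And>n x. \<bar>g n x\<bar> \<le> C * \<Phi> x"
    and times: "\<And>n. s n \<in> {0..T}" "\<And>n. t n \<in> {0..T}"
    and lim: "AE \<omega> in N. (\<lambda>n. mart (f n) (g n) (t n) \<omega>) \<longlonglongrightarrow> mart f' g' t' \<omega>"
      "AE \<omega> in N. (\<lambda>n. mart (f n) (g n) (s n) \<omega>) \<longlonglongrightarrow> mart f' g' s' \<omega>"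
  shows "(\<lambda>n. increment A (f n) (g n) r (s n) (t n)) \<longlonglongrightarrow> increment A f' g' r s' t'"
proof (rule integral_dominated_convergence[where w = "\<lambda>\<omega>. 2 * (C + C * total T \<omega>)"])
  have [measurable]: "(\<lambda>\<omega>. stop_path r (\<eta> \<omega>)) \<in> borel_measurable N" "A \<in> sets borel"
    using A by (auto intro: measurable_stop_path)
  have [measurable]: "mart (f n) (g n) u \<in> borel_measurable N" "mart f' g' u \<in> borel_measurable N" for n u
    using meas by (auto intro: measurable_mart)
  show "(\<lambda>\<omega>. indicator A (stop_path r (\<eta> \<omega>)) * (mart f' g' t' \<omega> - mart f' g' s' \<omega>)) \<in> borel_measurable N"
    "(\<lambda>\<omega>. indicator A (stop_path r (\<eta> \<omega>)) * (mart (f n) (g n) (t n) \<omega> - mart (f n) (g n) (s n) \<omega>)) \<in> borel_measurable N" for n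
    by measurable
  show "integrable N (\<lambda>\<omega>. 2 * (C + C * total T \<omega>))"
    by (intro integrable_mult_right integrable_dominating)
  show "AE \<omega> in N. (\<lambda>n. indicator A (stop_path r (\<eta> \<omega>)) * (mart (f n) (g n) (t n) \<omega> - mart (f n) (g n) (s n) \<omega>))
      \<longlonglongrightarrow> indicator A (stop_path r (\<eta> \<omega>)) * (mart f' g' t' \<omega> - mart f' g' s' \<omega>)"
    using lim by eventually_elim (intro tendsto_intros)
  show "AE \<omega> in N. norm (indicator A (stop_path r (\<eta> \<omega>)) * (mart (f n) (g n) (t n) \<omega> - mart (f n) (g n) (s n) \<omega>))
      \<le> 2 * (C + C * total T \<omega>)" for n
    using AE_mart_bound[OF meas(2) bound, where T = T]
  proof eventually_elim
    fix \<omega> assume "\<forall>u\<in>{0..T}. \<bar>mart (f n) (g n) u \<omega>\<bar> \<le> C + C * total T \<omega>"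
    then have "\<bar>mart (f n) (g n) (t n) \<omega>\<bar> \<le> C + C * total T \<omega>" "\<bar>mart (f n) (g n) (s n) \<omega>\<bar> \<le> C + C * total T \<omega>"
      using times by auto
    then have "\<bar>mart (f n) (g n) (t n) \<omega> - mart (f n) (g n) (s n) \<omega>\<bar> \<le> 2 * (C + C * total T \<omega>)"
      "0 \<le> C + C * total T \<omega>"
      using abs_triangle_ineq4[of "mart (f n) (g n) (t n) \<omega>" "mart (f n) (g n) (s n) \<omega>"]
      by (simp, meson abs_ge_zero order_trans)
    then show "norm (indicator A (stop_path r (\<eta> \<omega>)) * (mart (f n) (g n) (t n) \<omega> - mart (f n) (g n) (s n) \<omega>))
      \<le> 2 * (C + C * total T \<omega>)"
      by (auto simp: indicator_def)
  qed
qed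

lemma mart_time_tendsto:
  assumes f: "continuous_on UNIV f" and g: "g \<in> borel_measurable borel" "\<And>x. \<bar>g x\<bar> \<le> C * \<Phi> x"
    and q: "\<And>n. q n \<le> T" "q \<longlonglongrightarrow> t" "AE \<omega> in N. (\<lambda>n. X (q n) \<omega>) \<longlonglongrightarrow> X t \<omega>"
  shows "AE \<omega> in N. (\<lambda>n. mart f g (q n) \<omega>) \<longlonglongrightarrow> mart f g t \<omega>"
  using AE_set_integrable_Phi[of T] q(3) AE_space
proof eventually_elim
  fix \<omega> assume \<omega>: "set_integrable lborel {0..T} (\<lambda>s. \<Phi> (X s \<omega>))" "(\<lambda>n. X (q n) \<omega>) \<longlonglongrightarrow> X t \<omega>" "\<omega> \<in> space N"
  have "(\<lambda>n. f (X (q n) \<omega>)) \<longlonglongrightarrow> f (X t \<omega>)"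
    using f \<omega>(2) by (intro continuous_on_tendsto_compose[OF f]) auto
  moreover have "(\<lambda>n. LINT s:{0..q n}|lborel. g (X s \<omega>)) \<longlonglongrightarrow> (LINT s:{0..t}|lborel. g (X s \<omega>))"
    using set_integrable_dominated[OF g \<omega>(3,1) order_refl] q(1,2)
    by (rule set_integral_upper_limit_tendsto)
  ultimately show "(\<lambda>n. mart f g (q n) \<omega>) \<longlonglongrightarrow> mart f g t \<omega>"
    unfolding mart_def by (rule tendsto_diff)
qed

text \<open>Both times are approached from the right by rationals, since an event of the past of
  \<open>s\<close> belongs to the past of every later rational. Continuity of \<open>f\<close>
  carries convergence of the process over to \<open>f (X t \<omega>)\<close>.\<close>

lemma increment_zero_real_times:
  assumes f: "continuous_on UNIV f" "\<And>x. \<bar>f x\<bar> \<le> C"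
    and g: "g \<in> borel_measurable borel" "\<And>x. \<bar>g x\<bar> \<le> C * \<Phi> x"
    and rat: "\<And>p q A. 0 \<le> p \<Longrightarrow> p \<le> q \<Longrightarrow> A \<in> sets borel \<Longrightarrow> increment A f g (of_rat p) (of_rat p) (of_rat q) = 0"
    and st: "0 \<le> s" "s \<le> t" and A: "A \<in> sets borel"
  shows "increment A f g s s t = 0"
proof -
  have f_meas: "f \<in> borel_measurable borel"
    using f(1) by (rule borel_measurable_continuous_onI)
  have le: "increment A f g s (of_rat p) (of_rat q) = 0" if p: "s \<le> of_rat p" "p \<le> q" for p q
  proof -
    have "0 \<le> (of_rat p :: real)"
      using st(1) p(1) by linarith
    then have "0 \<le> p"
      by simp
    \<comment> \<open>Stopping at \<open>p\<close> and then at \<open>s\<close> is stopping at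
      \<open>s\<close>, so the event at time \<open>s\<close> becomes a Borel test event at time
      \<open>p\<close>.\<close>
    have "stop_path s \<in> borel_measurable (borel :: (rat \<Rightarrow> 'a) measure)"
      by (rule measurable_stop_path) simp
    from measurable_sets[OF this A] have "stop_path s -` A \<in> sets borel"
      by simp
    note zero = rat[OF \<open>0 \<le> p\<close> p(2) this]
    have "indicator (stop_path s -` A) (stop_path (of_rat p) y) = (indicator A (stop_path s y) :: real)" for y
      using stop_path_stop_path[OF p(1), of y] by (simp add: indicator_def)
    then show ?thesis
      using zero by simp
  qed
  \<comment> \<open>When \<open>s = t\<close>, the approximating rationals may come in the wrong
    order; exchanging the end points only changes the sign.\<close>
  have any: "increment A f g s (of_rat p) (of_rat q) = 0" if pq: "s \<le> of_rat p" "s \<le> of_rat q" for p q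
  proof (cases "p \<le> q")
    case False
    have "increment A f g s (of_rat p) (of_rat q) = - increment A f g s (of_rat q) (of_rat p)"
      by (subst Bochner_Integration.integral_minus[symmetric]) (simp add: algebra_simps)
    then show ?thesis
      using le[of q p] pq False by simp
  qed (use le pq in simp)
  obtain p where p: "\<And>n. s < of_rat (p n)" "\<And>n. of_rat (p n) \<le> s + 1"
      "(\<lambda>n. of_rat (p n)) \<longlonglongrightarrow> s" "AE \<omega> in N. (\<lambda>n. X (of_rat (p n)) \<omega>) \<longlonglongrightarrow> X s \<omega>"
    using rat_right_approx[OF st(1)] by blast
  obtain q where q: "\<And>n. t < of_rat (q n)" "\<And>n. of_rat (q n) \<le> t + 1"
      "(\<lambda>n. of_rat (q n)) \<longlonglongrightarrow> t" "AE \<omega> in N. (\<lambda>n. X (of_rat (q n)) \<omega>) \<longlonglongrightarrow> X t \<omega>"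
    using rat_right_approx[OF order_trans[OF st]] by blast
  have in_T: "of_rat (p n) \<in> {0..t + 1}" "of_rat (q n) \<in> {0..t + 1}" for n
  proof -
    have "0 \<le> (of_rat (p n) :: real)" "of_rat (p n) \<le> t + 1" "0 \<le> (of_rat (q n) :: real)" "of_rat (q n) \<le> t + 1"
      using p(1,2)[of n] q(1,2)[of n] st by linarith+
    then show "of_rat (p n) \<in> {0..t + 1}" "of_rat (q n) \<in> {0..t + 1}"
      by (simp_all only: atLeastAtMost_iff simp_thms)
  qed
  have "(\<lambda>n. increment A f g s (of_rat (p n)) (of_rat (q n))) \<longlonglongrightarrow> increment A f g s s t"
  proof (rule increment_tendsto[where T = "t + 1" and C = C])
    show "AE \<omega> in N. (\<lambda>n. mart f g (of_rat (q n)) \<omega>) \<longlonglongrightarrow> mart f g t \<omega>"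
      using in_T by (intro mart_time_tendsto[where T = "t + 1", OF f(1) g _ q(3,4)]) auto
    show "AE \<omega> in N. (\<lambda>n. mart f g (of_rat (p n)) \<omega>) \<longlonglongrightarrow> mart f g s \<omega>"
      using in_T by (intro mart_time_tendsto[where T = "t + 1", OF f(1) g _ p(3,4)]) auto
  qed (use A f f_meas g in_T in auto)
  moreover have "increment A f g s (of_rat (p n)) (of_rat (q n)) = 0" for n
    using p(1)[of n] q(1)[of n] st by (intro any) auto
  ultimately show ?thesis
    by (simp add: LIMSEQ_const_iff)
qed

text \<open>Bounded pointwise limits can lose continuity, so approximation in time is no longer
  possible here; the identity is carried through the closure at fixed real times. Multiplying the
  second component by \<Phi> turns its uniform bound into domination by \<open>C * \<Phi>\<close>.
  Measurability and boundedness are part of the invariant because the convergence argument uses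
  them.\<close>

lemma increment_zero_bp_closure:
  assumes gh: "(g, h) \<in> bp_closure S"
    and base: "\<And>g h. (g, h) \<in> S \<Longrightarrow> g \<in> borel_measurable borel \<and> h \<in> borel_measurable borel \<and>
      (\<exists>C. \<forall>x. \<bar>g x\<bar> \<le> C \<and> \<bar>h x\<bar> \<le> C) \<and>
      (\<forall>s t A. 0 \<le> s \<longrightarrow> s \<le> t \<longrightarrow> A \<in> sets borel \<longrightarrow> increment A g (\<lambda>x. h x * \<Phi> x) s s t = 0)"
  shows "g \<in> borel_measurable borel \<and> h \<in> borel_measurable borel \<and>
      (\<exists>C. \<forall>x. \<bar>g x\<bar> \<le> C \<and> \<bar>h x\<bar> \<le> C) \<and>
      (\<forall>s t A. 0 \<le> s \<longrightarrow> s \<le> t \<longrightarrow> A \<in> sets borel \<longrightarrow> increment A g (\<lambda>x. h x * \<Phi> x) s s t = 0)"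
proof -
  define R where "R p \<longleftrightarrow> fst p \<in> borel_measurable borel \<and> snd p \<in> borel_measurable borel \<and>
      (\<exists>C. \<forall>x. \<bar>fst p x\<bar> \<le> C \<and> \<bar>snd p x\<bar> \<le> C) \<and>
      (\<forall>s t A. 0 \<le> s \<longrightarrow> s \<le> t \<longrightarrow> A \<in> sets borel \<longrightarrow> increment A (fst p) (\<lambda>x. snd p x * \<Phi> x) s s t = 0)"
    for p :: "('a \<Rightarrow> real) \<times> ('a \<Rightarrow> real)"
  have "R (g, h)"
    using gh
  proof induction
    case (base p)
    then show ?case
      using assms(2)[of "fst p" "snd p"] by (simp add: R_def)
  next
    case (lim g h C g' h')
    have meas [measurable]: "g n \<in> borel_measurable borel" "h n \<in> borel_measurable borel" for n
      using lim.IH[of n] by (simp_all add: R_def)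
    have meas' [measurable]: "g' \<in> borel_measurable borel" "h' \<in> borel_measurable borel"
      using lim.hyps meas borel_measurable_LIMSEQ_real[of borel g g'] borel_measurable_LIMSEQ_real[of borel h h']
      by blast+
    have bound': "\<bar>g' x\<bar> \<le> C" "\<bar>h' x\<bar> \<le> C" for x
      using LIMSEQ_le_const2[OF tendsto_rabs[OF lim.hyps(4)]] LIMSEQ_le_const2[OF tendsto_rabs[OF lim.hyps(5)]]
        lim.hyps(2,3) by blast+
    have bound_Phi: "\<bar>h n x * \<Phi> x\<bar> \<le> C * \<Phi> x" "\<bar>h' x * \<Phi> x\<bar> \<le> C * \<Phi> x" for n x
      using mult_right_mono[OF lim.hyps(3) Phi_nonneg] mult_right_mono[OF bound'(2) Phi_nonneg] Phi_nonneg
      by (simp_all add: abs_mult)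
    have mart_lim: "AE \<omega> in N. (\<lambda>n. mart (g n) (\<lambda>x. h n x * \<Phi> x) t \<omega>) \<longlonglongrightarrow> mart g' (\<lambda>x. h' x * \<Phi> x) t \<omega>" for t
      using AE_set_integrable_Phi[of t] AE_space
    proof eventually_elim
      fix \<omega> assume \<omega>: "set_integrable lborel {0..t} (\<lambda>s. \<Phi> (X s \<omega>))" "\<omega> \<in> space N"
      have "(\<lambda>n. LINT s:{0..t}|lborel. h n (X s \<omega>) * \<Phi> (X s \<omega>)) \<longlonglongrightarrow> (LINT s:{0..t}|lborel. h' (X s \<omega>) * \<Phi> (X s \<omega>))"
        unfolding set_lebesgue_integral_def
      proof (rule integral_dominated_convergence[where w = "\<lambda>s. indicator {0..t} s *\<^sub>R (C * \<Phi> (X s \<omega>))"])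
        show "integrable lborel (\<lambda>s. indicator {0..t} s *\<^sub>R (C * \<Phi> (X s \<omega>)))"
          using set_integrable_mult_right[OF \<omega>(1), of C] unfolding set_integrable_def .
        show "AE s in lborel. (\<lambda>n. indicator {0..t} s *\<^sub>R (h n (X s \<omega>) * \<Phi> (X s \<omega>))) \<longlonglongrightarrow>
            indicator {0..t} s *\<^sub>R (h' (X s \<omega>) * \<Phi> (X s \<omega>))"
          by (intro AE_I2 tendsto_scaleR tendsto_mult tendsto_const lim.hyps(5))
        show "AE s in lborel. norm (indicator {0..t} s *\<^sub>R (h n (X s \<omega>) * \<Phi> (X s \<omega>))) \<le>
            indicator {0..t} s *\<^sub>R (C * \<Phi> (X s \<omega>))" for n
          using bound_Phi(1)[of n] by (intro AE_I2) (auto simp: indicator_def)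
      qed (use \<omega>(2) in measurable)
      then show "(\<lambda>n. mart (g n) (\<lambda>x. h n x * \<Phi> x) t \<omega>) \<longlonglongrightarrow> mart g' (\<lambda>x. h' x * \<Phi> x) t \<omega>"
        unfolding mart_def by (rule tendsto_diff[OF lim.hyps(4)])
    qed
    have "increment A g' (\<lambda>x. h' x * \<Phi> x) s s t = 0" if st: "0 \<le> s" "s \<le> t" "A \<in> sets borel" for s t A
    proof -
      have "(\<lambda>n. increment A (g n) (\<lambda>x. h n x * \<Phi> x) s s t) \<longlonglongrightarrow> increment A g' (\<lambda>x. h' x * \<Phi> x) s s t"
      proof (rule increment_tendsto[where T = t and C = C])
        show "\<bar>g n x\<bar> \<le> C" "\<bar>h n x * \<Phi> x\<bar> \<le> C * \<Phi> x" for n x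
          by (fact lim.hyps(2) bound_Phi(1))+
        show "s \<in> {0..t}" "t \<in> {0..t}"
          using st by auto
        show "A \<in> sets borel" "AE \<omega> in N. (\<lambda>n. mart (g n) (\<lambda>x. h n x * \<Phi> x) s \<omega>) \<longlonglongrightarrow> mart g' (\<lambda>x. h' x * \<Phi> x) s \<omega>"
          "AE \<omega> in N. (\<lambda>n. mart (g n) (\<lambda>x. h n x * \<Phi> x) t \<omega>) \<longlonglongrightarrow> mart g' (\<lambda>x. h' x * \<Phi> x) t \<omega>"
          by (fact st(3) mart_lim)+
        show "(\<lambda>x. h n x * \<Phi> x) \<in> borel_measurable borel" "(\<lambda>x. h' x * \<Phi> x) \<in> borel_measurable borel" for n
          by measurable
      qed (fact meas meas')+
      moreover have "increment A (g n) (\<lambda>x. h n x * \<Phi> x) s s t = 0" for n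
        using lim.IH[of n] st by (simp add: R_def)
      ultimately show ?thesis
        by (simp add: LIMSEQ_const_iff)
    qed
    then show ?case
      unfolding R_def fst_conv snd_conv using meas' bound' by blast
  qed
  then show ?thesis
    by (simp add: R_def)
qed

lemma past_subalgebra: "subalgebra N (past s)"
  unfolding subalgebra_def past_def
  using sets_image_in_sets[OF refl measurable_stop_path[OF measurable_eta], of s] by simp

lemma past_mono: "s \<le> t \<Longrightarrow> subalgebra (past t) (past s)"
proof -
  assume "s \<le> t"
  have "(\<lambda>\<omega>. stop_path s (stop_path t (\<eta> \<omega>))) \<in> borel_measurable (past t)"
    by (rule measurable_stop_path) measurable
  then have "(\<lambda>\<omega>. stop_path s (\<eta> \<omega>)) \<in> borel_measurable (past t)"
    using stop_path_stop_path[OF \<open>s \<le> t\<close>] by (metis (no_types, lifting) ext)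
  from sets_image_in_sets[OF space_past this] show ?thesis
    unfolding subalgebra_def past_def[of s] by (simp add: space_past)
qed

text \<open>Every event of the filtration at time \<open>s\<close> is a preimage under the stopped
  path, so vanishing increments characterise the conditional expectation.\<close>

lemma is_martingale_mart:
  assumes meas: "f \<in> borel_measurable borel" "g \<in> borel_measurable borel"
    and bound: "\<And>x. \<bar>f x\<bar> \<le> C" "\<And>x. \<bar>g x\<bar> \<le> C * \<Phi> x"
    and incr: "\<And>s t A. 0 \<le> s \<Longrightarrow> s \<le> t \<Longrightarrow> A \<in> sets borel \<Longrightarrow> increment A f g s s t = 0"
  shows "is_martingale N (star_filtration N X) (mart f g)"
proof -
  let ?F = "star_filtration N X"
  have sub: "subalgebra N (?F t)" if "0 \<le> t" for t
    using past_subalgebra[of t] sets_star_filtration[OF that]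
    by (simp add: subalgebra_def space_star_filtration)
  moreover have "subalgebra (?F t) (?F s)" if "0 \<le> s" "s \<le> t" for s t
    using past_mono[OF that(2)] sets_star_filtration[of s] sets_star_filtration[of t] that
    by (simp add: subalgebra_def space_star_filtration)
  moreover have adapted: "mart f g t \<in> borel_measurable (?F t)" if "0 \<le> t" for t
  proof -
    have "mart f g t \<in> borel_measurable (past t)"
      unfolding mart_def
      by (intro borel_measurable_diff measurable_compose[OF measurable_X_past meas(1)]
          measurable_integral_past meas that order_refl)
    then show ?thesis
      using sets_star_filtration[OF that] by (simp cong: measurable_cong_sets)
  qed
  moreover have int: "integrable N (mart f g t)" if "0 \<le> t" for t
    using meas bound that by (rule integrable_mart)
  moreover have "AE \<omega> in N. real_cond_exp N (?F s) (mart f g t) \<omega> = mart f g s \<omega>" if st: "0 \<le> s" "s \<le> t" for s t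
  proof -
    interpret finite_measure_subalgebra N "?F s"
      by unfold_locales (rule sub[OF st(1)])
    have t: "0 \<le> t"
      using st by simp
    show ?thesis
    proof (rule real_cond_exp_charact)
      fix E assume "E \<in> sets (?F s)"
      then obtain A where A: "A \<in> sets borel" and E: "E = (\<lambda>\<omega>. stop_path s (\<eta> \<omega>)) -` A \<inter> space N"
        unfolding sets_star_filtration[OF st(1)] past_def by (subst (asm) sets_vimage_algebra2) auto
      have [measurable]: "E \<in> sets N"
        using \<open>E \<in> sets (?F s)\<close> sub[OF st(1)] by (auto simp: subalgebra_def)
      have set_int: "set_integrable N E (mart f g u)" if "0 \<le> u" for u
        unfolding set_integrable_def using int[OF that] by (intro integrable_mult_indicator) auto
      have "(LINT \<omega>:E|N. mart f g t \<omega>) - (LINT \<omega>:E|N. mart f g s \<omega>) = (LINT \<omega>:E|N. mart f g t \<omega> - mart f g s \<omega>)"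
        by (intro set_integral_diff(2)[symmetric] set_int st t)
      also have "\<dots> = increment A f g s s t"
        unfolding set_lebesgue_integral_def
        by (intro Bochner_Integration.integral_cong) (auto simp: E indicator_def)
      also have "\<dots> = 0"
        by (rule incr[OF st A])
      finally show "(LINT \<omega>:E|N. mart f g t \<omega>) = (LINT \<omega>:E|N. mart f g s \<omega>)"
        by simp
    qed (use int adapted st t in auto)
  qed
  ultimately show ?thesis
    unfolding is_martingale_def by blast
qed

text \<open>The tests are extended three times: from the generator to Borel events by the Dynkin
  argument, from rational to real times by right limits, and from \<open>fs\<close> to all of
  \<open>D\<close> by the bp-closure.\<close>

theorem mp_solution_X:
  fixes D :: "('a \<Rightarrow> real) set" and A :: "('a \<Rightarrow> real) \<Rightarrow> 'a \<Rightarrow> real" and fs :: "nat \<Rightarrow> 'a \<Rightarrow> real"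
    and B :: "nat \<Rightarrow> (rat \<Rightarrow> 'a) set"
  assumes dom: "D \<subseteq> Cb"
    and ran: "\<And>f. f \<in> D \<Longrightarrow> A f \<in> borel_measurable borel"
    and Phi_bound: "\<And>f. f \<in> D \<Longrightarrow> \<exists>C. \<forall>x. \<bar>A f x\<bar> \<le> C * \<Phi> x"
    and fs: "range fs \<subseteq> D"
    and closure: "{(f, \<lambda>x. A f x / \<Phi> x) | f. f \<in> D} \<subseteq> bp_closure {(fs n, \<lambda>x. A (fs n) x / \<Phi> x) | n. True}"
    and B: "Int_stable (range B)" "UNIV \<in> range B" "sets borel = sigma_sets UNIV (range B)"
    and initial: "AE \<omega> in N. \<eta> \<omega> 0 = x"
    and tests: "\<And>n m p q. 0 \<le> p \<Longrightarrow> p \<le> q \<Longrightarrow> increment (B m) (fs n) (A (fs n)) (of_rat p) (of_rat p) (of_rat q) = 0"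
  shows "mp_solution D A \<Phi> (return borel x) N X"
proof -
  have D_bound: "\<exists>C. \<forall>x. \<bar>f x\<bar> \<le> C \<and> \<bar>A f x\<bar> \<le> C * \<Phi> x \<and> \<bar>A f x / \<Phi> x\<bar> \<le> C" if "f \<in> D" for f
  proof -
    have "bounded (range f)"
      using dom \<open>f \<in> D\<close> by (auto simp: Cb_def)
    then obtain C1 where C1: "\<And>x. \<bar>f x\<bar> \<le> C1"
      unfolding bounded_iff by auto
    obtain C2 where C2: "\<And>x. \<bar>A f x\<bar> \<le> C2 * \<Phi> x"
      using Phi_bound[OF \<open>f \<in> D\<close>] by blast
    \<comment> \<open>One constant for both bounds. The absolute value covers a negative
      \<open>C2\<close>, which is possible when \<Phi> vanishes identically.\<close>
    define C where "C = max C1 \<bar>C2\<bar>"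
    have bound: "\<bar>A f x\<bar> \<le> C * \<Phi> x" for x
      using C2[of x] mult_right_mono[of C2 C "\<Phi> x"] Phi_nonneg[of x] unfolding C_def by linarith
    have "0 \<le> C"
      unfolding C_def by linarith
    then have "\<bar>A f x / \<Phi> x\<bar> \<le> C" for x
      using bound[of x] Phi_nonneg[of x] by (cases "\<Phi> x = 0") (simp_all add: abs_divide pos_divide_le_eq)
    moreover have "\<bar>f x\<bar> \<le> C" for x
      using C1[of x] unfolding C_def by linarith
    ultimately show ?thesis
      using bound by blast
  qed
  \<comment> \<open>Division by 0 yields 0, and \<open>A f\<close> vanishes wherever \<Phi> does, so
    cancellation holds at those points too.\<close>
  have D_cancel: "A f x / \<Phi> x * \<Phi> x = A f x" if "f \<in> D" for f x
  proof (cases "\<Phi> x = 0")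
    case True
    obtain C where "\<bar>A f x\<bar> \<le> C * \<Phi> x"
      using Phi_bound[OF \<open>f \<in> D\<close>] by blast
    with True show ?thesis by simp
  qed simp
  have D_meas: "f \<in> borel_measurable borel" if "f \<in> D" for f
    using dom that unfolding Cb_def by (auto intro: borel_measurable_continuous_onI)
  have base: "increment E (fs n) (A (fs n)) s s t = 0" if st: "0 \<le> s" "s \<le> t" and E: "E \<in> sets borel" for s t E n
  proof -
    have fD: "fs n \<in> D"
      using fs by auto
    obtain C where C: "\<And>x. \<bar>fs n x\<bar> \<le> C" "\<And>x. \<bar>A (fs n) x\<bar> \<le> C * \<Phi> x"
      using D_bound[OF fD] by blast
    show ?thesis
    proof (rule increment_zero_real_times[OF _ C(1) ran[OF fD] C(2) _ st E])
      show "continuous_on UNIV (fs n)"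
        using dom fD by (auto simp: Cb_def)
      fix p q :: rat and G :: "(rat \<Rightarrow> 'a) set" assume pq: "0 \<le> p" "p \<le> q" and G: "G \<in> sets borel"
      have pq_real: "0 \<le> (of_rat p :: real)" "0 \<le> (of_rat q :: real)"
        using pq by auto
      show "increment G (fs n) (A (fs n)) (of_rat p) (of_rat p) (of_rat q) = 0"
        using tests[OF pq]
        by (intro expectation_indicator_zero[OF _ _ B _ G] measurable_stop_path[OF measurable_eta]
            Bochner_Integration.integrable_diff integrable_mart[OF D_meas[OF fD] ran[OF fD] C] pq_real) auto
    qed
  qed
  have mart: "is_martingale N (star_filtration N X) (mart f (A f))" if f: "f \<in> D" for f
  proof -
    obtain C where C: "\<And>x. \<bar>f x\<bar> \<le> C" "\<And>x. \<bar>A f x\<bar> \<le> C * \<Phi> x"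
      using D_bound[OF f] by blast
    have "\<forall>s t E. 0 \<le> s \<longrightarrow> s \<le> t \<longrightarrow> E \<in> sets borel \<longrightarrow> increment E f (\<lambda>x. A f x / \<Phi> x * \<Phi> x) s s t = 0"
    proof -
      have "(f, \<lambda>x. A f x / \<Phi> x) \<in> bp_closure {(fs n, \<lambda>x. A (fs n) x / \<Phi> x) | n. True}"
        using closure f by auto
      from increment_zero_bp_closure[OF this] show ?thesis
      proof (rule conjunct2[OF conjunct2[OF conjunct2]])
        fix g h assume "(g, h) \<in> {(fs n, \<lambda>x. A (fs n) x / \<Phi> x) | n. True}"
        then obtain n where n: "g = fs n" "h = (\<lambda>x. A (fs n) x / \<Phi> x)"
          by auto
        have fD: "fs n \<in> D"
          using fs by auto
        have eq: "(\<lambda>x. h x * \<Phi> x) = A (fs n)"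
          using D_cancel[OF fD] by (simp add: n(2))
        have "h \<in> borel_measurable borel"
          unfolding n(2) using ran[OF fD] by measurable
        then show "g \<in> borel_measurable borel \<and> h \<in> borel_measurable borel \<and>
          (\<exists>C. \<forall>x. \<bar>g x\<bar> \<le> C \<and> \<bar>h x\<bar> \<le> C) \<and>
          (\<forall>s t A. 0 \<le> s \<longrightarrow> s \<le> t \<longrightarrow> A \<in> sets borel \<longrightarrow> increment A g (\<lambda>x. h x * \<Phi> x) s s t = 0)"
          using D_meas[OF fD] D_bound[OF fD] base unfolding eq n(1) by (auto simp: n(2))
      qed
    qed
    then show ?thesis
      using D_cancel[OF f] by (intro is_martingale_mart[OF D_meas[OF f] ran[OF f] C]) simp_all
  qed
  have "distr N borel (X 0) = distr N borel (\<lambda>_. x)"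
    using initial X_of_rat[of 0] by (intro distr_cong_AE) auto
  also have "\<dots> = return borel x"
    by (rule distr_const) simp
  finally have "distr N borel (X 0) = return borel x" .
  then show ?thesis
    unfolding mp_solution_def
    using prob_space_axioms measurable_process_X Phi_integral_real mart by (simp add: mart_def[abs_def])
qed

end

section \<open>Codes of solutions\<close>

text \<open>Written as a functional of a rational path, so that expectations of its increments
  depend on the law of the path only.\<close>

definition path_mart ::
    "(nat \<Rightarrow> nat) \<Rightarrow> ('a::polish_space \<Rightarrow> real) \<Rightarrow> ('a \<Rightarrow> real) \<Rightarrow> real \<Rightarrow> (rat \<Rightarrow> 'a) \<Rightarrow> real" where
  "path_mart K f g t y = f (path_lim K y t) - (LINT s:{0..t}|lborel. g (path_lim K y s))"

text \<open>
  The sequence \<open>K\<close> is a modulus of continuity in probability at rational times: it makes the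
  approximations in \<open>path_lim\<close> converge almost surely. For the events \<open>B\<close> below a countable
  \<open>\<inter>\<close>-stable generator is used.
\<close>

definition solution_code ::
    "('a::polish_space \<Rightarrow> real) \<Rightarrow> (nat \<Rightarrow> 'a \<Rightarrow> real) \<Rightarrow> (nat \<Rightarrow> 'a \<Rightarrow> real) \<Rightarrow> (nat \<Rightarrow> (rat \<Rightarrow> 'a) set) \<Rightarrow>
     'a \<Rightarrow> (nat \<Rightarrow> nat) \<Rightarrow> 'w measure \<Rightarrow> ('w \<Rightarrow> rat \<Rightarrow> 'a) \<Rightarrow> bool" where
  "solution_code \<Phi> fs gs B x K N \<eta> \<longleftrightarrow>
     (\<forall>n. K n \<le> K (Suc n)) \<and> (\<forall>n. n \<le> K n) \<and>
     (\<forall>n q q'. q \<in> {0..of_nat n} \<longrightarrow> q' \<in> {0..of_nat n} \<longrightarrow> \<bar>q - q'\<bar> \<le> 1 / fact (K n) \<longrightarrow>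
        (LINT \<omega>|N. min 1 (dist (\<eta> \<omega> q) (\<eta> \<omega> q'))) \<le> (1/2) ^ n) \<and>
     (LINT \<omega>|N. min 1 (dist (\<eta> \<omega> 0) x)) = 0 \<and>
     (\<forall>n. (\<integral>\<^sup>+\<omega>. (\<integral>\<^sup>+s\<in>{0..real n}. ennreal (\<Phi> (path_lim K (\<eta> \<omega>) s)) \<partial>lborel) \<partial>N) < \<infinity>) \<and>
     (\<forall>n m p q. 0 \<le> p \<longrightarrow> p \<le> q \<longrightarrow>
        (LINT \<omega>|N. indicator (B m) (stop_path (of_rat p) (\<eta> \<omega>)) *
           (path_mart K (fs n) (gs n) (of_rat q) (\<eta> \<omega>) - path_mart K (fs n) (gs n) (of_rat p) (\<eta> \<omega>))) = 0)"

lemma measurable_path_lim_pair: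
  fixes y :: "'m \<Rightarrow> rat \<Rightarrow> 'a::polish_space"
  assumes [measurable]: "\<And>n. (\<lambda>x. K x n) \<in> M \<rightarrow>\<^sub>M count_space UNIV" "y \<in> borel_measurable M"
  shows "(\<lambda>(x, s). path_lim (K x) (y x) s) \<in> M \<Otimes>\<^sub>M lborel \<rightarrow>\<^sub>M borel"
  unfolding split_beta' by (rule measurable_path_lim) measurable

lemma measurable_path_mart:
  fixes y :: "'m \<Rightarrow> rat \<Rightarrow> 'a::polish_space"
  assumes [measurable]: "\<And>n. (\<lambda>x. K x n) \<in> M \<rightarrow>\<^sub>M count_space UNIV" "y \<in> borel_measurable M"
    "f \<in> borel_measurable borel" "g \<in> borel_measurable borel"
  shows "(\<lambda>x. path_mart (K x) f g t (y x)) \<in> borel_measurable M"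
proof -
  have [measurable]: "(\<lambda>x. path_lim (K x) (y x) t) \<in> borel_measurable M"
    by (rule measurable_path_lim) measurable
  note measurable_path_lim_pair[OF assms(1,2), measurable]
  have "(\<lambda>x. LINT s:{0..t}|lborel. g (path_lim (K x) (y x) s)) \<in> borel_measurable M"
    unfolding set_lebesgue_integral_def
    by (rule lborel.borel_measurable_lebesgue_integral) (unfold split_beta', measurable)
  then show ?thesis
    unfolding path_mart_def by measurable
qed

lemma measurable_path_nn_integral:
  fixes y :: "'m \<Rightarrow> rat \<Rightarrow> 'a::polish_space"
  assumes [measurable]: "\<And>n. (\<lambda>x. K x n) \<in> M \<rightarrow>\<^sub>M count_space UNIV" "y \<in> borel_measurable M"
    "\<Phi> \<in> borel_measurable borel"
  shows "(\<lambda>x. \<integral>\<^sup>+s\<in>{0..t}. ennreal (\<Phi> (path_lim (K x) (y x) s)) \<partial>lborel) \<in> borel_measurable M"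
proof -
  note measurable_path_lim_pair[OF assms(1,2), measurable]
  show ?thesis
    by (rule lborel.borel_measurable_nn_integral) (unfold split_beta', measurable)
qed

text \<open>Every probabilistic condition is an integral of a path functional and so depends on the
  law alone. This moves codes from one sample space to another.\<close>

lemma solution_code_distr:
  fixes \<eta> :: "'w \<Rightarrow> rat \<Rightarrow> 'a::polish_space"
  assumes \<eta> [measurable]: "\<eta> \<in> borel_measurable N" and [measurable]: "\<Phi> \<in> borel_measurable borel"
    "\<And>n. fs n \<in> borel_measurable borel" "\<And>n. gs n \<in> borel_measurable borel" "\<And>m. B m \<in> sets borel"
  shows "solution_code \<Phi> fs gs B x K (distr N borel \<eta>) (\<lambda>y. y) \<longleftrightarrow> solution_code \<Phi> fs gs B x K N \<eta>"
proof -
  have [measurable]: "(\<lambda>y::rat \<Rightarrow> 'a. y q) \<in> borel_measurable borel" for q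
    by (rule measurable_path_apply) simp
  have [measurable]: "(\<lambda>y::rat \<Rightarrow> 'a. stop_path s y) \<in> borel_measurable borel" for s
    by (rule measurable_stop_path) simp
  have [measurable]: "(\<lambda>y. path_mart K (fs n) (gs n) t y) \<in> borel_measurable borel" for n t
    by (rule measurable_path_mart) measurable
  have [measurable]: "(\<lambda>y. \<integral>\<^sup>+s\<in>{0..t}. ennreal (\<Phi> (path_lim K y s)) \<partial>lborel) \<in> borel_measurable borel" for t
    by (rule measurable_path_nn_integral) measurable
  show ?thesis
    unfolding solution_code_def by (simp add: integral_distr nn_integral_distr)
qed

lemma solution_code_imp_solution:
  fixes D :: "('a::polish_space \<Rightarrow> real) set" and A :: "('a \<Rightarrow> real) \<Rightarrow> 'a \<Rightarrow> real"
  assumes N: "prob_space N" and \<eta> [measurable]: "\<eta> \<in> borel_measurable N"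
    and dom: "D \<subseteq> Cb"
    and ran: "\<And>f. f \<in> D \<Longrightarrow> A f \<in> borel_measurable borel"
    and Phi: "\<Phi> \<in> borel_measurable borel" "\<And>x. 0 \<le> \<Phi> x"
    and Phi_bound: "\<And>f. f \<in> D \<Longrightarrow> \<exists>C. \<forall>x. \<bar>A f x\<bar> \<le> C * \<Phi> x"
    and fs: "range fs \<subseteq> D"
    and closure: "{(f, \<lambda>x. A f x / \<Phi> x) | f. f \<in> D} \<subseteq> bp_closure {(fs n, \<lambda>x. A (fs n) x / \<Phi> x) | n. True}"
    and B: "Int_stable (range B)" "UNIV \<in> range B" "sets borel = sigma_sets UNIV (range B)"
    and code: "solution_code \<Phi> fs (\<lambda>n. A (fs n)) B x K N \<eta>"
  shows "mp_solution D A \<Phi> (return borel x) N (\<lambda>t \<omega>. path_lim K (\<eta> \<omega>) t)"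
    and "continuous_in_probability N (\<lambda>t \<omega>. path_lim K (\<eta> \<omega>) t)"
proof -
  interpret prob_space N by (rule N)
  interpret path_code N K \<eta>
    using code unfolding solution_code_def
    by unfold_locales (auto simp: incseq_Suc_iff)
  have X_eq: "X = (\<lambda>t \<omega>. path_lim K (\<eta> \<omega>) t)"
    by (simp add: X_def fun_eq_iff)
  interpret integrable_path_code N K \<eta> \<Phi>
    using code unfolding solution_code_def
    by unfold_locales (auto simp: X_eq intro: Phi)
  show "continuous_in_probability N (\<lambda>t \<omega>. path_lim K (\<eta> \<omega>) t)"
    using continuous_in_probability_X unfolding X_eq .
  have mart_eq: "mart f g t \<omega> = path_mart K f g t (\<eta> \<omega>)" for f g t \<omega>
    by (simp add: mart_def path_mart_def X_eq)
  have "expectation (\<lambda>\<omega>. min 1 (dist (\<eta> \<omega> 0) x)) = 0"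
    using code unfolding solution_code_def by blast
  then have "AE \<omega> in N. min 1 (dist (\<eta> \<omega> 0) x) = 0"
    by (subst (asm) integral_nonneg_eq_0_iff_AE) (auto intro!: integrable_const_bound[of _ 1])
  then have initial: "AE \<omega> in N. \<eta> \<omega> 0 = x"
    by eventually_elim (auto simp: min_def split: if_splits)
  have "mp_solution D A \<Phi> (return borel x) N X"
  proof (rule mp_solution_X[OF dom ran Phi_bound fs closure B initial])
    fix n m :: nat and p q :: rat assume "0 \<le> p" "p \<le> q"
    then show "expectation (\<lambda>\<omega>. indicator (B m) (stop_path (of_rat p) (\<eta> \<omega>)) *
        (mart (fs n) (A (fs n)) (of_rat q) \<omega> - mart (fs n) (A (fs n)) (of_rat p) \<omega>)) = 0"
      using code unfolding solution_code_def mart_eq by blast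
  qed
  then show "mp_solution D A \<Phi> (return borel x) N (\<lambda>t \<omega>. path_lim K (\<eta> \<omega>) t)"
    unfolding X_eq .
qed

section \<open>From a solution to its code\<close>

lemma martingale_increment_zero:
  assumes M: "prob_space M" and mart: "is_martingale M F Y" and st: "0 \<le> s" "s \<le> t" and E: "E \<in> sets (F s)"
  shows "(LINT \<omega>|M. indicator E \<omega> * (Y t \<omega> - Y s \<omega>)) = 0"
proof -
  interpret prob_space M by (rule M)
  have sub: "subalgebra M (F s)" and int: "integrable M (Y t)" "integrable M (Y s)"
    and cond: "AE \<omega> in M. real_cond_exp M (F s) (Y t) \<omega> = Y s \<omega>"
    using mart st unfolding is_martingale_def by auto
  interpret finite_measure_subalgebra M "F s"
    by unfold_locales (rule sub)
  have [measurable]: "E \<in> sets M"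
    using E sub by (auto simp: subalgebra_def)
  have [measurable]: "Y s \<in> borel_measurable M"
    using int by auto
  have int_E: "integrable M (\<lambda>\<omega>. indicator E \<omega> * Y t \<omega>)" "integrable M (\<lambda>\<omega>. indicator E \<omega> * Y s \<omega>)"
    using integrable_mult_indicator[OF \<open>E \<in> sets M\<close> int(1)] integrable_mult_indicator[OF \<open>E \<in> sets M\<close> int(2)] by simp_all
  have "(LINT \<omega>:E|M. Y t \<omega>) = (LINT \<omega>:E|M. real_cond_exp M (F s) (Y t) \<omega>)"
    by (rule real_cond_exp_intA[OF int(1) E])
  also have "\<dots> = (LINT \<omega>:E|M. Y s \<omega>)"
    unfolding set_lebesgue_integral_def using cond by (intro integral_cong_AE) auto
  finally show ?thesis
    unfolding set_lebesgue_integral_def by (simp add: right_diff_distrib Bochner_Integration.integral_diff[OF int_E])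
qed

text \<open>Compactness: a sequence of bad pairs has a subsequence along which both members tend to
  one time \<open>l\<close>. The assumption \<open>tri\<close> merges triangle inequality and
  symmetry, so both members can be compared with \<open>l\<close> in the same argument
  position.\<close>

lemma uniform_modulus:
  fixes gap :: "real \<Rightarrow> real \<Rightarrow> real"
  assumes tri: "\<And>s t u. gap s u \<le> gap s t + gap u t"
    and cont: "\<And>s sk. 0 \<le> s \<Longrightarrow> (\<And>k. 0 \<le> sk k) \<Longrightarrow> sk \<longlonglongrightarrow> s \<Longrightarrow> (\<lambda>k. gap (sk k) s) \<longlonglongrightarrow> 0"
    and e: "0 < e"
  shows "\<exists>\<delta>>0. \<forall>s\<in>{0..T}. \<forall>t\<in>{0..T}. \<bar>s - t\<bar> \<le> \<delta> \<longrightarrow> gap s t \<le> e"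
proof (rule ccontr)
  assume neg: "\<not> ?thesis"
  have "\<exists>s t. s \<in> {0..T} \<and> t \<in> {0..T} \<and> \<bar>s - t\<bar> \<le> 1 / Suc k \<and> e < gap s t" for k
  proof -
    have "0 < 1 / real (Suc k)"
      by simp
    with neg have "\<not> (\<forall>s\<in>{0..T}. \<forall>t\<in>{0..T}. \<bar>s - t\<bar> \<le> 1 / real (Suc k) \<longrightarrow> gap s t \<le> e)"
      by blast
    then show ?thesis
      unfolding Ball_def not_all not_imp not_le by blast
  qed
  then obtain s t where st: "\<And>k. s k \<in> {0..T}" "\<And>k. t k \<in> {0..T}" "\<And>k. \<bar>s k - t k\<bar> \<le> 1 / Suc k"
      "\<And>k. e < gap (s k) (t k)"
    by metis
  obtain l r where l: "l \<in> {0..T}" "strict_mono r" "(s \<circ> r) \<longlonglongrightarrow> l"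
    using compact_Icc[of 0 T, unfolded compact_def, rule_format, of s] st(1) by blast
  have "(\<lambda>k. s (r k) - t (r k)) \<longlonglongrightarrow> 0"
  proof (rule Lim_null_comparison)
    have "\<bar>s (r k) - t (r k)\<bar> \<le> inverse (Suc k)" for k
    proof -
      have "1 / real (Suc (r k)) \<le> 1 / real (Suc k)"
        using strict_mono_imp_increasing[OF l(2), of k] by (intro divide_left_mono) auto
      then show ?thesis
        using st(3)[of "r k"] by (simp add: inverse_eq_divide)
    qed
    then show "eventually (\<lambda>k. norm (s (r k) - t (r k)) \<le> inverse (real (Suc k))) sequentially"
      by (intro always_eventually) simp
  qed (rule LIMSEQ_inverse_real_of_nat)
  from tendsto_diff[OF l(3) this] have t_lim: "(\<lambda>k. t (r k)) \<longlonglongrightarrow> l"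
    by (simp add: comp_def)
  have "(\<lambda>k. gap (s (r k)) l + gap (t (r k)) l) \<longlonglongrightarrow> 0 + 0"
    using l st(1,2) t_lim by (intro tendsto_add cont) (auto simp: comp_def)
  then have "eventually (\<lambda>k. gap (s (r k)) l + gap (t (r k)) l < e) sequentially"
    using e by (intro order_tendstoD) auto
  then obtain k where "gap (s (r k)) l + gap (t (r k)) l < e"
    by (auto simp: eventually_sequentially)
  then show False
    using tri[of "s (r k)" "t (r k)" l] st(4)[of "r k"] by linarith
qed

lemma modulus_sequence:
  fixes P :: "nat \<Rightarrow> real \<Rightarrow> bool"
  assumes ex: "\<And>n. \<exists>\<delta>>0. P n \<delta>" and mono: "\<And>n \<delta> \<delta>'. P n \<delta> \<Longrightarrow> \<delta>' \<le> \<delta> \<Longrightarrow> P n \<delta>'"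
  obtains K :: "nat \<Rightarrow> nat" where "\<And>n. K n \<le> K (Suc n)" "\<And>n. n \<le> K n" "\<And>n. P n (1 / fact (K n))"
proof -
  have "\<exists>k::nat. P n (1 / fact k)" for n
  proof -
    obtain \<delta> where \<delta>: "0 < \<delta>" "P n \<delta>"
      using ex by blast
    obtain k where k: "1 / \<delta> < real k"
      using reals_Archimedean2 by blast
    have "real k \<le> fact k"
      using fact_ge_self[of k] by (metis of_nat_fact of_nat_le_iff)
    with k have "1 / \<delta> \<le> fact k"
      by linarith
    then have "1 / fact k \<le> \<delta>"
      using \<delta>(1) by (simp add: field_simps)
    then show ?thesis
      using mono[OF \<delta>(2)] by blast
  qed
  then obtain k :: "nat \<Rightarrow> nat" where k: "\<And>n. P n (1 / fact (k n))"
    by metis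
  \<comment> \<open>The partial sums make \<open>K\<close> monotone and at least \<open>k n\<close>;
    the summand \<open>n\<close> ensures \<open>n \<le> K n\<close>.\<close>
  define K where "K n = n + (\<Sum>i\<le>n. k i)" for n
  have "k n \<le> K n" for n
    unfolding K_def by (simp add: member_le_sum trans_le_add2)
  then have "(1::real) / fact (K n) \<le> 1 / fact (k n)" for n
    by (intro divide_left_mono fact_mono) auto
  then have "P n (1 / fact (K n))" for n
    using mono[OF k] by blast
  then show thesis
    by (intro that[of K]) (simp_all add: K_def)
qed

text \<open>Negative rationals are sent to time 0, because a solution is constrained at nonnegative
  times only. The last conclusion says that decoding returns the solution at each fixed time almost
  surely, so its one-dimensional laws can be read off the code.\<close>

lemma solution_has_code:
  fixes X :: "real \<Rightarrow> 'w \<Rightarrow> 'a::polish_space" and D :: "('a \<Rightarrow> real) set" and fs :: "nat \<Rightarrow> 'a \<Rightarrow> real"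
  defines "\<xi> \<equiv> \<lambda>\<omega> q. X (of_rat (max 0 q)) \<omega>"
  assumes sol: "mp_solution D A \<Phi> (return borel x) M X" and cont: "continuous_in_probability M X"
    and dom: "D \<subseteq> Cb" and ran: "\<And>f. f \<in> D \<Longrightarrow> A f \<in> borel_measurable borel"
    and Phi_meas [measurable]: "\<Phi> \<in> borel_measurable borel"
    and fs: "range fs \<subseteq> D" and B [measurable]: "\<And>m. B m \<in> sets borel"
  shows "\<xi> \<in> borel_measurable M"
    and "\<exists>K. solution_code \<Phi> fs (\<lambda>n. A (fs n)) B x K M \<xi> \<and>
      (\<forall>t\<ge>0. AE \<omega> in M. path_lim K (\<xi> \<omega>) t = X t \<omega>)"
proof -
  interpret prob_space M
    using sol by (simp add: mp_solution_def)
  have process: "(\<lambda>(t, \<omega>). X t \<omega>) \<in> restrict_space borel {0..} \<Otimes>\<^sub>M M \<rightarrow>\<^sub>M borel"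
    using sol by (simp add: mp_solution_def measurable_process_def)
  have X_comp: "(\<lambda>p. X (max 0 (s p)) (w p)) \<in> borel_measurable L"
    if [measurable]: "s \<in> borel_measurable L" "w \<in> L \<rightarrow>\<^sub>M M" for L s and w :: "'b \<Rightarrow> 'w"
  proof -
    have "(\<lambda>p. (max 0 (s p), w p)) \<in> L \<rightarrow>\<^sub>M restrict_space borel {0..} \<Otimes>\<^sub>M M"
      by (intro measurable_Pair measurable_restrict_space2) auto
    from measurable_compose[OF this process] show ?thesis
      by simp
  qed
  have X_meas [measurable]: "X (max 0 t) \<in> borel_measurable M" for t
    using X_comp[of "\<lambda>_. t" M "\<lambda>\<omega>. \<omega>"] by simp
  have X_meas_nonneg: "X t \<in> borel_measurable M" if "0 \<le> t" for t
    using X_meas[of t] that by (simp add: max_absorb2)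
  have of_rat_max: "(of_rat (max 0 q) :: real) = max 0 (of_rat q)" for q
    by (simp add: max_def)
  show xi_meas [measurable]: "\<xi> \<in> borel_measurable M"
    unfolding \<xi>_def of_rat_max by (rule measurable_coordinatewise_then_product) measurable
  have xi_nonneg: "\<xi> \<omega> q = X (of_rat q) \<omega>" if "0 \<le> q" for \<omega> q
    using that by (simp add: \<xi>_def max_absorb2)
  define gap where "gap s t = expectation (\<lambda>\<omega>. min 1 (dist (X (max 0 s) \<omega>) (X (max 0 t) \<omega>)))" for s t
  have gap_int: "integrable M (\<lambda>\<omega>. min 1 (dist (X (max 0 s) \<omega>) (X (max 0 t) \<omega>)))" for s t
    by (intro integrable_const_bound[of _ 1]) auto
  have gap_nonneg: "0 \<le> gap s t" for s t
    unfolding gap_def by (intro integral_nonneg_AE) auto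
  have gap_tri: "gap s u \<le> gap s t + gap u t" for s t u
  proof -
    have "min 1 (dist a c) \<le> min 1 (dist a b) + min 1 (dist c b)" for a b c :: 'a
      using dist_triangle2[of a c b] zero_le_dist[of a b] zero_le_dist[of c b] by linarith
    then show ?thesis
      unfolding gap_def
      by (subst Bochner_Integration.integral_add[OF gap_int gap_int, symmetric])
        (intro integral_mono gap_int Bochner_Integration.integrable_add)
  qed
  have gap_tendsto: "(\<lambda>k. gap (sk k) s) \<longlonglongrightarrow> 0"
    if s: "0 \<le> s" "\<And>k. 0 \<le> sk k" "sk \<longlonglongrightarrow> s" for s :: real and sk :: "nat \<Rightarrow> real"
  proof (rule order_tendstoI)
    fix r :: real assume "r < 0"
    then show "eventually (\<lambda>k. r < gap (sk k) s) sequentially"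
      using gap_nonneg by (auto intro!: always_eventually intro: less_le_trans)
  next
    fix r :: real assume r: "0 < r"
    have "(\<lambda>k. prob {\<omega> \<in> space M. r / 2 < dist (X (sk k) \<omega>) (X s \<omega>)}) \<longlonglongrightarrow> 0"
      using cont s half_gt_zero[OF r] unfolding continuous_in_probability_def by blast
    then have "eventually (\<lambda>k. prob {\<omega> \<in> space M. r / 2 < dist (X (sk k) \<omega>) (X s \<omega>)} < r / 2) sequentially"
      using r by (intro order_tendstoD) auto
    then show "eventually (\<lambda>k. gap (sk k) s < r) sequentially"
    proof eventually_elim
      fix k assume small: "prob {\<omega> \<in> space M. r / 2 < dist (X (sk k) \<omega>) (X s \<omega>)} < r / 2"
      note [measurable] = X_meas_nonneg[OF s(1)] X_meas_nonneg[OF s(2)]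
      let ?S = "{\<omega> \<in> space M. r / 2 < dist (X (sk k) \<omega>) (X s \<omega>)}"
      have int_S: "integrable M (indicator ?S :: _ \<Rightarrow> real)"
        by (rule integrable_real_indicator) (auto simp: emeasure_eq_measure)
      then have "integrable M (\<lambda>\<omega>. r / 2 + indicator ?S \<omega>)"
        by simp
      \<comment> \<open>The truncated distance is at most \<open>r / 2\<close> plus the indicator of
        the event that the distance exceeds \<open>r / 2\<close>.\<close>
      then have "gap (sk k) s \<le> expectation (\<lambda>\<omega>. r / 2 + indicator ?S \<omega>)"
        unfolding gap_def using s(1) s(2)[of k] r
        by (intro integral_mono gap_int) (auto simp: indicator_def max_absorb2 min_le_iff_disj)
      also have "\<dots> = r / 2 + prob ?S"
        by (subst Bochner_Integration.integral_add[OF _ int_S]) (simp_all add: prob_space)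
      finally show "gap (sk k) s < r"
        using small by linarith
    qed
  qed
  \<comment> \<open>Continuity in probability is uniform on each compact interval, which yields a
    modulus of the required form.\<close>
  obtain K where K: "\<And>n. K n \<le> K (Suc n)" "\<And>n. n \<le> K n" and
    modulus: "\<And>n. \<forall>s\<in>{0..real n}. \<forall>t\<in>{0..real n}. \<bar>s - t\<bar> \<le> 1 / fact (K n) \<longrightarrow> gap s t \<le> (1/2) ^ n"
  proof (rule modulus_sequence[of "\<lambda>n \<delta>. \<forall>s\<in>{0..real n}. \<forall>t\<in>{0..real n}. \<bar>s - t\<bar> \<le> \<delta> \<longrightarrow> gap s t \<le> (1/2) ^ n"])
    show "\<exists>\<delta>>0. \<forall>s\<in>{0..real n}. \<forall>t\<in>{0..real n}. \<bar>s - t\<bar> \<le> \<delta> \<longrightarrow> gap s t \<le> (1/2) ^ n" for n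
      using gap_tri gap_tendsto by (intro uniform_modulus) auto
  qed (auto intro: order_trans)
  have lim_eq: "AE \<omega> in M. path_lim K (\<xi> \<omega>) t = X t \<omega>" if t: "0 \<le> t" for t
  proof -
    obtain n0 where n0: "t \<le> real n0"
      using real_arch_simple by blast
    have nonneg: "0 \<le> (of_rat (rat_approx K n t) :: real)" for n
      using rat_approx_nonneg[OF t, of K n] by simp
    have "AE \<omega> in M. summable (\<lambda>n. dist (X (max 0 (of_rat (rat_approx K n t))) \<omega>) (X (max 0 t) \<omega>))"
    proof (rule AE_summable_of_summable_expectation[where ?n0.0 = n0])
      fix n assume "n0 \<le> n"
      then have "t \<le> real n"
        using n0 by linarith
      moreover have "\<bar>of_rat (rat_approx K n t) - t\<bar> \<le> 1 / fact (K n)"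
        using rat_approx_le[of K n t] rat_approx_gt[of t K n] by linarith
      moreover have "of_rat (rat_approx K n t) \<le> real n"
        using rat_approx_le[of K n t] \<open>t \<le> real n\<close> by linarith
      ultimately have "gap (of_rat (rat_approx K n t)) t \<le> (1/2) ^ n"
        using modulus[rule_format, of "of_rat (rat_approx K n t)" n t] t nonneg[of n]
        by (simp only: atLeastAtMost_iff simp_thms)
      then show "expectation (\<lambda>\<omega>. min 1 (dist (X (max 0 (of_rat (rat_approx K n t))) \<omega>) (X (max 0 t) \<omega>))) \<le> (1/2) ^ n"
        unfolding gap_def .
    qed auto
    then show ?thesis
    proof eventually_elim
      fix \<omega> assume "summable (\<lambda>n. dist (X (max 0 (of_rat (rat_approx K n t))) \<omega>) (X (max 0 t) \<omega>))"
      from summable_LIMSEQ_zero[OF this]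
      have "(\<lambda>n. X (max 0 (of_rat (rat_approx K n t))) \<omega>) \<longlonglongrightarrow> X (max 0 t) \<omega>"
        by (rule tendsto_dist_iff[THEN iffD2])
      then have "(\<lambda>n. \<xi> \<omega> (rat_approx K n t)) \<longlonglongrightarrow> X t \<omega>"
        using nonneg t by (simp add: xi_nonneg max_absorb2)
      then show "path_lim K (\<xi> \<omega>) t = X t \<omega>"
        unfolding path_lim_def by (rule limI)
    qed
  qed
  have [measurable]: "(\<lambda>p. path_lim K (\<xi> (snd p)) (max 0 (fst p))) \<in> borel_measurable (lborel \<Otimes>\<^sub>M M)"
    by (rule measurable_path_lim) measurable
  have [measurable]: "(\<lambda>p. X (max 0 (fst p)) (snd p)) \<in> borel_measurable (lborel \<Otimes>\<^sub>M M)"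
    by (rule X_comp) measurable
  \<comment> \<open>Fubini exchanges the quantifiers: equality almost surely at each time becomes,
    for almost every \<omega>, equality at almost every time, which is all that time integrals see.
    Phrasing it as vanishing distance exhibits the measurable set that the exchange
    requires.\<close>
  have time_eq: "AE \<omega> in M. AE s in lborel. 0 \<le> s \<longrightarrow> path_lim K (\<xi> \<omega>) s = X s \<omega>"
  proof -
    interpret pair_sigma_finite lborel M ..
    have "AE s in lborel. AE \<omega> in M. dist (path_lim K (\<xi> \<omega>) (max 0 s)) (X (max 0 s) \<omega>) = 0"
      using lim_eq by simp
    moreover have "{p \<in> space (lborel \<Otimes>\<^sub>M M). dist (path_lim K (\<xi> (snd p)) (max 0 (fst p))) (X (max 0 (fst p)) (snd p)) = 0}
        \<in> sets (lborel \<Otimes>\<^sub>M M)"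
      by measurable
    ultimately have "AE \<omega> in M. AE s in lborel. dist (path_lim K (\<xi> \<omega>) (max 0 s)) (X (max 0 s) \<omega>) = 0"
      using AE_commute[of "\<lambda>s \<omega>. dist (path_lim K (\<xi> \<omega>) (max 0 s)) (X (max 0 s) \<omega>) = 0"] by blast
    then show ?thesis
      by (auto elim!: eventually_mono simp: max_absorb2)
  qed
  have time_meas [measurable]: "(\<lambda>s. X (max 0 s) \<omega>) \<in> borel_measurable lborel"
      "(\<lambda>s. path_lim K (\<xi> \<omega>) s) \<in> borel_measurable lborel" if "\<omega> \<in> space M" for \<omega>
    using that by (auto intro!: X_comp measurable_path_lim)
  have fs_D: "fs n \<in> D" for n
    using fs by auto
  have fs_meas [measurable]: "fs n \<in> borel_measurable borel" "A (fs n) \<in> borel_measurable borel" for n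
    using dom fs_D[of n] ran unfolding Cb_def by (auto intro: borel_measurable_continuous_onI)
  define Y where "Y n t \<omega> = fs n (X t \<omega>) - (LINT s:{0..t}|lborel. A (fs n) (X s \<omega>))" for n t \<omega>
  have mart: "is_martingale M (star_filtration M X) (Y n)" for n
    using sol fs_D[of n] unfolding mp_solution_def Y_def[abs_def] by blast
  have mart_eq: "AE \<omega> in M. path_mart K (fs n) (A (fs n)) t (\<xi> \<omega>) = Y n t \<omega>" if "0 \<le> t" for n t
    using lim_eq[OF that] time_eq AE_space
  proof eventually_elim
    fix \<omega> assume \<omega>: "path_lim K (\<xi> \<omega>) t = X t \<omega>" "AE s in lborel. 0 \<le> s \<longrightarrow> path_lim K (\<xi> \<omega>) s = X s \<omega>" "\<omega> \<in> space M"
    note [measurable] = time_meas[OF \<omega>(3)]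
    have "(LINT s:{0..t}|lborel. A (fs n) (path_lim K (\<xi> \<omega>) s)) = (LINT s:{0..t}|lborel. A (fs n) (X (max 0 s) \<omega>))"
      unfolding set_lebesgue_integral_def
      by (rule integral_cong_AE) (use \<omega>(2) in \<open>auto elim!: eventually_mono simp: indicator_def max_absorb2\<close>)
    also have "\<dots> = (LINT s:{0..t}|lborel. A (fs n) (X s \<omega>))"
      by (intro set_lebesgue_integral_cong) (auto simp: max_absorb2)
    finally show "path_mart K (fs n) (A (fs n)) t (\<xi> \<omega>) = Y n t \<omega>"
      unfolding path_mart_def Y_def \<omega>(1) by simp
  qed
  have "solution_code \<Phi> fs (\<lambda>n. A (fs n)) B x K M \<xi>"
    unfolding solution_code_def
  proof (intro conjI allI impI)
    fix n and q q' :: rat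
    assume q: "q \<in> {0..of_nat n}" "q' \<in> {0..of_nat n}" "\<bar>q - q'\<bar> \<le> 1 / fact (K n)"
    have le: "(of_rat r :: real) \<le> real n" if "r \<le> of_nat n" for r
      using that of_rat_less_eq[of r "of_nat n", where 'a = real] by simp
    have diff: "(of_rat r - of_rat r' :: real) \<le> 1 / fact (K n)" if "r - r' \<le> 1 / fact (K n)" for r r'
      using that of_rat_less_eq[of "r - r'" "1 / fact (K n)", where 'a = real]
      by (simp add: of_rat_diff of_rat_divide)
    have "gap (of_rat q) (of_rat q') \<le> (1/2) ^ n"
      using modulus[of n] q le[of q] le[of q'] diff[of q q'] diff[of q' q] by (auto simp: abs_le_iff)
    then show "expectation (\<lambda>\<omega>. min 1 (dist (\<xi> \<omega> q) (\<xi> \<omega> q'))) \<le> (1/2) ^ n"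
      unfolding gap_def \<xi>_def of_rat_max .
  next
    have "distr M borel (X 0) = return borel x"
      using sol unfolding mp_solution_def by blast
    moreover have "AE y in return borel x. y = x"
      by (subst AE_return) auto
    ultimately have "AE y in distr M borel (X 0). y = x"
      by (simp only:)
    then have "AE \<omega> in M. X 0 \<omega> = x"
      using X_meas_nonneg[of 0] by (subst (asm) AE_distr_iff) auto
    then show "expectation (\<lambda>\<omega>. min 1 (dist (\<xi> \<omega> 0) x)) = 0"
      by (intro integral_eq_zero_AE) (auto elim!: eventually_mono simp: xi_nonneg)
  next
    fix n
    have "(\<integral>\<^sup>+\<omega>. (\<integral>\<^sup>+s\<in>{0..real n}. ennreal (\<Phi> (path_lim K (\<xi> \<omega>) s)) \<partial>lborel) \<partial>M) =
        (\<integral>\<^sup>+\<omega>. (\<integral>\<^sup>+s\<in>{0..real n}. ennreal (\<Phi> (X s \<omega>)) \<partial>lborel) \<partial>M)"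
    proof (rule nn_integral_cong_AE)
      show "AE \<omega> in M. (\<integral>\<^sup>+s\<in>{0..real n}. ennreal (\<Phi> (path_lim K (\<xi> \<omega>) s)) \<partial>lborel) =
          (\<integral>\<^sup>+s\<in>{0..real n}. ennreal (\<Phi> (X s \<omega>)) \<partial>lborel)"
        using time_eq
        by eventually_elim (auto intro!: nn_integral_cong_AE elim!: eventually_mono simp: indicator_def)
    qed
    also have "\<dots> < \<infinity>"
      using sol by (simp add: mp_solution_def)
    finally show "(\<integral>\<^sup>+\<omega>. (\<integral>\<^sup>+s\<in>{0..real n}. ennreal (\<Phi> (path_lim K (\<xi> \<omega>) s)) \<partial>lborel) \<partial>M) < \<infinity>" .
  next
    fix n m and p q :: rat assume pq: "0 \<le> p" "p \<le> q"
    then have pq_real: "0 \<le> (of_rat p :: real)" "of_rat p \<le> (of_rat q :: real)" "0 \<le> (of_rat q :: real)"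
      by (auto simp: of_rat_less_eq)
    \<comment> \<open>The filtration of a general solution may exceed the past generated at rational
      times, unlike that of a decoded process. What is shown is that it contains this past, so the
      martingale property applies to the test events.\<close>
    let ?F = "star_filtration M X (of_rat p)"
    have space_F: "space ?F = space M"
      unfolding star_filtration_def by (rule space_measure_of) auto
    have X_F: "X u \<in> borel_measurable ?F" if "0 \<le> u" "u \<le> of_rat p" for u
    proof (rule measurableI)
      fix C :: "'a set" assume "C \<in> sets borel"
      with that show "X u -` C \<inter> space ?F \<in> sets ?F"
        unfolding space_F unfolding star_filtration_def
        by (subst sets_measure_of) (blast intro: sigma_sets.Basic)+
    qed simp
    have "(\<lambda>\<omega>. stop_path (of_rat p) (\<xi> \<omega>)) \<in> borel_measurable ?F"
    proof (rule measurable_coordinatewise_then_product)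
      fix r
      show "(\<lambda>\<omega>. stop_path (of_rat p) (\<xi> \<omega>) r) \<in> borel_measurable ?F"
        using X_F[of "of_rat r"] X_F[of 0] pq_real
        by (cases "0 \<le> r \<and> (of_rat r :: real) \<le> of_rat p") (auto simp: stop_path_def xi_nonneg)
    qed
    from measurable_sets[OF this B]
    have E: "(\<lambda>\<omega>. stop_path (of_rat p) (\<xi> \<omega>)) -` B m \<inter> space M \<in> sets ?F" (is "?E \<in> _")
      by (simp add: space_F)
    have "(LINT \<omega>|M. indicator (B m) (stop_path (of_rat p) (\<xi> \<omega>)) *
           (path_mart K (fs n) (A (fs n)) (of_rat q) (\<xi> \<omega>) - path_mart K (fs n) (A (fs n)) (of_rat p) (\<xi> \<omega>))) =
        (LINT \<omega>|M. indicator ?E \<omega> * (Y n (of_rat q) \<omega> - Y n (of_rat p) \<omega>))"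
    proof (rule integral_cong_AE)
      have [measurable]: "(\<lambda>\<omega>. stop_path s (\<xi> \<omega>)) \<in> borel_measurable M"
          "(\<lambda>\<omega>. path_mart K (fs n) (A (fs n)) s (\<xi> \<omega>)) \<in> borel_measurable M" for s
        by (rule measurable_stop_path measurable_path_mart; measurable)+
      show "(\<lambda>\<omega>. indicator (B m) (stop_path (of_rat p) (\<xi> \<omega>)) * (path_mart K (fs n) (A (fs n)) (of_rat q) (\<xi> \<omega>) -
          path_mart K (fs n) (A (fs n)) (of_rat p) (\<xi> \<omega>))) \<in> borel_measurable M"
        by measurable
      have "Y n u \<in> borel_measurable M" if "0 \<le> u" for u
        using mart[of n] that unfolding is_martingale_def by (blast intro: borel_measurable_integrable)
      note [measurable] = this[OF pq_real(1)] this[OF pq_real(3)]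
      have [measurable]: "?E \<in> sets M"
        using mart[of n] pq_real(1) E unfolding is_martingale_def subalgebra_def by (meson subsetD)
      show "(\<lambda>\<omega>. indicator ?E \<omega> * (Y n (of_rat q) \<omega> - Y n (of_rat p) \<omega>)) \<in> borel_measurable M"
        by measurable
      show "AE \<omega> in M. indicator (B m) (stop_path (of_rat p) (\<xi> \<omega>)) *
           (path_mart K (fs n) (A (fs n)) (of_rat q) (\<xi> \<omega>) - path_mart K (fs n) (A (fs n)) (of_rat p) (\<xi> \<omega>)) =
         indicator ?E \<omega> * (Y n (of_rat q) \<omega> - Y n (of_rat p) \<omega>)"
        using mart_eq[OF pq_real(1), of n] mart_eq[OF pq_real(3), of n] AE_space
        by eventually_elim (simp add: indicator_def)
    qed
    also have "\<dots> = 0"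
      by (rule martingale_increment_zero[OF prob_space_axioms mart pq_real(1,2) E])
    finally show "(LINT \<omega>|M. indicator (B m) (stop_path (of_rat p) (\<xi> \<omega>)) *
           (path_mart K (fs n) (A (fs n)) (of_rat q) (\<xi> \<omega>) - path_mart K (fs n) (A (fs n)) (of_rat p) (\<xi> \<omega>))) = 0" .
  qed (use K in auto)
  with lim_eq show "\<exists>K. solution_code \<Phi> fs (\<lambda>n. A (fs n)) B x K M \<xi> \<and>
      (\<forall>t\<ge>0. AE \<omega> in M. path_lim K (\<xi> \<omega>) t = X t \<omega>)"
    by blast
qed

section \<open>Measurability of the transition function\<close>

text \<open>The measure \<open>N\<close> stays fixed while the parameter moves the random path, so
  Fubini makes each integral measurable in the parameter; all quantifiers range over countable
  types.\<close>

lemma pred_solution_code: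
  fixes \<Theta> :: "'m \<Rightarrow> 'w \<Rightarrow> rat \<Rightarrow> 'a::polish_space"
  assumes N: "sigma_finite_measure N"
    and K [measurable]: "\<And>n. (\<lambda>p. K p n) \<in> M \<rightarrow>\<^sub>M count_space UNIV"
    and \<Theta>: "(\<lambda>(p, \<omega>). \<Theta> p \<omega>) \<in> M \<Otimes>\<^sub>M N \<rightarrow>\<^sub>M borel"
    and x [measurable]: "x \<in> borel_measurable M"
    and [measurable]: "\<Phi> \<in> borel_measurable borel" "\<And>n. fs n \<in> borel_measurable borel"
      "\<And>n. gs n \<in> borel_measurable borel" "\<And>m. B m \<in> sets borel"
  shows "Measurable.pred M (\<lambda>p. solution_code \<Phi> fs gs B (x p) (K p) N (\<Theta> p))"
proof -
  interpret sigma_finite_measure N by (rule N)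
  have \<Theta>' [measurable]: "(\<lambda>v. \<Theta> (fst v) (snd v)) \<in> borel_measurable (M \<Otimes>\<^sub>M N)"
    using \<Theta> by (simp add: split_beta')
  have K' [measurable]: "(\<lambda>v. K (fst v) n) \<in> M \<Otimes>\<^sub>M N \<rightarrow>\<^sub>M count_space UNIV" for n
    by (rule measurable_compose[OF measurable_fst K])
  have [measurable]: "(\<lambda>v. \<Theta> (fst v) (snd v) q) \<in> borel_measurable (M \<Otimes>\<^sub>M N)" for q
    by (rule measurable_path_apply) measurable
  have [measurable]: "(\<lambda>v. stop_path s (\<Theta> (fst v) (snd v))) \<in> borel_measurable (M \<Otimes>\<^sub>M N)" for s
    by (rule measurable_stop_path) measurable
  have [measurable]: "(\<lambda>v. path_mart (K (fst v)) (fs n) (gs n) t (\<Theta> (fst v) (snd v))) \<in> borel_measurable (M \<Otimes>\<^sub>M N)" for n t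
    by (rule measurable_path_mart) measurable
  have [measurable]: "(\<lambda>v. \<integral>\<^sup>+s\<in>{0..t}. ennreal (\<Phi> (path_lim (K (fst v)) (\<Theta> (fst v) (snd v)) s)) \<partial>lborel) \<in> borel_measurable (M \<Otimes>\<^sub>M N)" for t
    by (rule measurable_path_nn_integral) measurable
  have integral: "(\<lambda>p. LINT \<omega>|N. h p \<omega>) \<in> borel_measurable M"
    if "(\<lambda>v. h (fst v) (snd v)) \<in> borel_measurable (M \<Otimes>\<^sub>M N)" for h :: "'m \<Rightarrow> 'w \<Rightarrow> real"
    using that by (intro borel_measurable_lebesgue_integral) (simp add: split_beta')
  have [measurable]: "(\<lambda>p. LINT \<omega>|N. min 1 (dist (\<Theta> p \<omega> q) (\<Theta> p \<omega> q'))) \<in> borel_measurable M" for q q'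
    by (rule integral) measurable
  have [measurable]: "(\<lambda>p. LINT \<omega>|N. min 1 (dist (\<Theta> p \<omega> 0) (x p))) \<in> borel_measurable M"
    by (rule integral) measurable
  have [measurable]: "(\<lambda>p. LINT \<omega>|N. indicator (B m) (stop_path (of_rat r) (\<Theta> p \<omega>)) *
           (path_mart (K p) (fs n) (gs n) (of_rat q) (\<Theta> p \<omega>) - path_mart (K p) (fs n) (gs n) (of_rat r) (\<Theta> p \<omega>))) \<in> borel_measurable M" for n m q r
    by (rule integral) measurable
  have [measurable]: "(\<lambda>p. \<integral>\<^sup>+\<omega>. (\<integral>\<^sup>+s\<in>{0..t}. ennreal (\<Phi> (path_lim (K p) (\<Theta> p \<omega>) s)) \<partial>lborel) \<partial>N) \<in> borel_measurable M" for t
    by (rule borel_measurable_nn_integral) (simp add: split_beta')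
  have K_pred: "Measurable.pred M (\<lambda>p. R (K p n))" for R and n :: nat
    by (rule measurable_compose[OF K]) simp
  have [measurable]: "Measurable.pred M (\<lambda>p. K p n \<le> K p (Suc n))" for n
    by (rule measurable_compose_countable[where g = "\<lambda>p. K p n" and f = "\<lambda>k p. k \<le> K p (Suc n)"])
      (rule K_pred K)+
  have [measurable]: "Measurable.pred M (\<lambda>p. n \<le> K p n)" "Measurable.pred M (\<lambda>p. \<bar>q - q'\<bar> \<le> 1 / fact (K p n))"
    for n and q q' :: rat
    by (rule K_pred)+
  show ?thesis
    unfolding solution_code_def by measurable
qed

theorem theorem3p2:
  fixes D :: "('a::polish_space \<Rightarrow> real) set"
    and A :: "('a \<Rightarrow> real) \<Rightarrow> 'a \<Rightarrow> real"
    and \<Phi> :: "'a \<Rightarrow> real"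
    and M :: "'a \<Rightarrow> 'w measure"
    and X :: "'a \<Rightarrow> real \<Rightarrow> 'w \<Rightarrow> 'a"
  assumes dom: "D \<subseteq> Cb"
    and ran: "\<And>f. f \<in> D \<Longrightarrow> A f \<in> borel_measurable borel"
    and Phi_measurable: "\<Phi> \<in> borel_measurable borel"
    and Phi_nonneg: "\<And>x. 0 \<le> \<Phi> x"
    and Phi_bound: "\<And>f. f \<in> D \<Longrightarrow> \<exists>C. \<forall>x. \<bar>A f x\<bar> \<le> C * \<Phi> x"
    and separable: "\<exists>fs :: nat \<Rightarrow> 'a \<Rightarrow> real. range fs \<subseteq> D \<and>
          {(f, \<lambda>x. A f x / \<Phi> x) | f. f \<in> D} \<subseteq>
            bp_closure {(fs n, \<lambda>x. A (fs n) x / \<Phi> x) | n. True}"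
    and well_posed: "\<And>x. mp_well_posed D A \<Phi> (return borel x)"
    and solution: "\<And>x. mp_solution D A \<Phi> (return borel x) (M x) (X x)"
    and cont_prob: "\<And>x. continuous_in_probability (M x) (X x)"
  shows "\<forall>t\<ge>0. \<forall>B\<in>sets borel.
           (\<lambda>x. measure (M x) {\<omega> \<in> space (M x). X x t \<omega> \<in> B}) \<in> borel_measurable borel"
proof (intro allI impI ballI)
  fix t :: real and E :: "'a set" assume t: "0 \<le> t" and E [measurable]: "E \<in> sets borel"
  obtain fs :: "nat \<Rightarrow> 'a \<Rightarrow> real" where fs: "range fs \<subseteq> D" and
    closure: "{(f, \<lambda>x. A f x / \<Phi> x) | f. f \<in> D} \<subseteq> bp_closure {(fs n, \<lambda>x. A (fs n) x / \<Phi> x) | n. True}"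
    using separable by blast
  obtain B :: "nat \<Rightarrow> (rat \<Rightarrow> 'a) set" where
    B: "Int_stable (range B)" "UNIV \<in> range B" "sets borel = sigma_sets UNIV (range B)"
    using second_countable_generator by blast
  obtain \<Theta> :: "(rat \<Rightarrow> real) \<Rightarrow> real \<Rightarrow> rat \<Rightarrow> 'a" where
    \<Theta>: "(\<lambda>(F, \<omega>). \<Theta> F \<omega>) \<in> borel \<Otimes>\<^sub>M unit_lborel \<rightarrow>\<^sub>M borel" and
    \<Theta>_surj: "\<And>\<nu>. prob_space \<nu> \<Longrightarrow> sets \<nu> = sets borel \<Longrightarrow> \<exists>F. distr unit_lborel borel (\<Theta> F) = \<nu>"
    using law_code by blast
  interpret unit: prob_space unit_lborel
    by (rule prob_space_unit_lborel)
  have \<Theta>_meas [measurable]: "\<Theta> F \<in> borel_measurable unit_lborel" for F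
    using measurable_compose[OF measurable_Pair1'[of F borel] \<Theta>] by simp
  have fs_D: "fs n \<in> D" for n
    using fs by auto
  have fs_meas [measurable]: "fs n \<in> borel_measurable borel" "A (fs n) \<in> borel_measurable borel" for n
    using dom fs_D[of n] ran unfolding Cb_def by (auto intro: borel_measurable_continuous_onI)
  have B_meas: "B m \<in> sets borel" for m
    using B(3) by auto
  note code_distr = solution_code_distr[where fs = fs and gs = "\<lambda>n. A (fs n)" and B = B and \<Phi> = \<Phi>,
      OF _ Phi_measurable fs_meas B_meas]
  \<comment> \<open>Real sequences stand in for integer ones, so the parameters \<open>z\<close>
    range over a Polish space of real functions; truncation to \<open>nat\<close> decodes each of
    them.\<close>
  define K :: "(rat \<Rightarrow> real) \<times> (nat \<Rightarrow> real) \<Rightarrow> nat \<Rightarrow> nat" where "K z n = nat \<lfloor>snd z n\<rfloor>" for z n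
  define code where
    "code x z \<longleftrightarrow> solution_code \<Phi> fs (\<lambda>n. A (fs n)) B x (K z) unit_lborel (\<Theta> (fst z))" for x z
  define P where "P z = unit.prob {\<omega> \<in> space unit_lborel. path_lim (K z) (\<Theta> (fst z) \<omega>) t \<in> E}" for z
  define p where "p x = measure (M x) {\<omega> \<in> space (M x). X x t \<omega> \<in> E}" for x
  have path_lim_meas [measurable]: "(\<lambda>y. path_lim k y s) \<in> borel_measurable borel" for k s
    by (rule measurable_path_lim) auto
  \<comment> \<open>The law of the given solution at rational times is realised on (0,1); the code
    condition and the probability of \<open>E\<close> at time \<open>t\<close> pass through that
    law.\<close>
  have code_exists: "\<exists>z. code x z \<and> P z = p x" for x
  proof -
    define \<xi> where "\<xi> = (\<lambda>\<omega> q. X x (of_rat (max 0 q)) \<omega>)"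
    have \<xi>_meas [measurable]: "\<xi> \<in> borel_measurable (M x)"
      unfolding \<xi>_def using solution[of x] cont_prob[of x] dom ran Phi_measurable fs B_meas
      by (rule solution_has_code(1))
    have "\<exists>k. solution_code \<Phi> fs (\<lambda>n. A (fs n)) B x k (M x) \<xi> \<and>
        (\<forall>s\<ge>0. AE \<omega> in M x. path_lim k (\<xi> \<omega>) s = X x s \<omega>)"
      unfolding \<xi>_def using solution[of x] cont_prob[of x] dom ran Phi_measurable fs B_meas
      by (rule solution_has_code(2))
    then obtain k where k: "solution_code \<Phi> fs (\<lambda>n. A (fs n)) B x k (M x) \<xi>"
        and lim_eq: "\<forall>s\<ge>0. AE \<omega> in M x. path_lim k (\<xi> \<omega>) s = X x s \<omega>"
      by (elim exE conjE)
    interpret prob_space "M x"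
      using solution by (simp add: mp_solution_def)
    obtain F where F: "distr unit_lborel borel (\<Theta> F) = distr (M x) borel \<xi>"
      using \<Theta>_surj[OF prob_space_distr[OF \<xi>_meas]] by auto
    let ?z = "(F, \<lambda>n. real (k n))"
    have K_z: "K ?z = k"
      by (simp add: K_def fun_eq_iff)
    have "code x ?z"
      using k code_distr[OF \<Theta>_meas[of F], where x = x and K = k] code_distr[OF \<xi>_meas, where x = x and K = k]
      unfolding code_def K_z F by simp
    moreover have "P ?z = p x"
    proof -
      have "P ?z = measure (distr unit_lborel borel (\<Theta> F)) {y. path_lim k y t \<in> E}"
        unfolding P_def K_z by (subst measure_distr) (auto simp: vimage_def Int_def conj_commute)
      also have "\<dots> = prob {\<omega> \<in> space (M x). path_lim k (\<xi> \<omega>) t \<in> E}"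
        unfolding F by (subst measure_distr) (auto simp: vimage_def Int_def conj_commute)
      also have "\<dots> = p x"
        unfolding p_def
      proof (rule finite_measure_eq_AE)
        have "(\<lambda>\<omega>. path_lim k (\<xi> \<omega>) t) \<in> borel_measurable (M x)"
          by (rule measurable_path_lim) auto
        then show "{\<omega> \<in> space (M x). path_lim k (\<xi> \<omega>) t \<in> E} \<in> events"
          by measurable
        show "{\<omega> \<in> space (M x). X x t \<omega> \<in> E} \<in> events"
        proof -
          have Pair_t: "(\<lambda>\<omega>. (t, \<omega>)) \<in> M x \<rightarrow>\<^sub>M restrict_space borel {0..} \<Otimes>\<^sub>M M x"
            using t by (intro measurable_Pair1') (simp add: space_restrict_space)
          have "(\<lambda>(s, \<omega>). X x s \<omega>) \<in> restrict_space borel {0..} \<Otimes>\<^sub>M M x \<rightarrow>\<^sub>M borel"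
            using solution[of x] unfolding mp_solution_def measurable_process_def by blast
          from measurable_compose[OF Pair_t this] have "X x t \<in> borel_measurable (M x)"
            by simp
          then show ?thesis
            by measurable
        qed
        show "AE \<omega> in M x. \<omega> \<in> {\<omega> \<in> space (M x). path_lim k (\<xi> \<omega>) t \<in> E} \<longleftrightarrow> \<omega> \<in> {\<omega> \<in> space (M x). X x t \<omega> \<in> E}"
          using lim_eq[rule_format, OF t] by eventually_elim simp
      qed
      finally show ?thesis .
    qed
    ultimately show ?thesis
      by blast
  qed
  \<comment> \<open>Decoded processes live on a measure over the reals, within the scope of the
    uniqueness assumption even when the given solutions are not.\<close>
  have P_unique: "P z = P z'" if "code x z" "code x z'" for x z z'
  proof -
    let ?X = "\<lambda>z t \<omega>. path_lim (K z) (\<Theta> (fst z) \<omega>) t"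
    have sol: "mp_solution D A \<Phi> (return borel x) unit_lborel (?X v)" if "code x v" for v
      using prob_space_unit_lborel \<Theta>_meas[of "fst v"] dom ran Phi_measurable Phi_nonneg Phi_bound fs closure B that[unfolded code_def]
      by (rule solution_code_imp_solution(1))
    have cont: "continuous_in_probability unit_lborel (?X v)" if "code x v" for v
      using prob_space_unit_lborel \<Theta>_meas[of "fst v"] dom ran Phi_measurable Phi_nonneg Phi_bound fs closure B that[unfolded code_def]
      by (rule solution_code_imp_solution(2))
    have "same_fdd unit_lborel (?X z) unit_lborel (?X z')"
      using well_posed[of x] sol[OF that(1)] sol[OF that(2)] cont[OF that(1)] cont[OF that(2)]
      unfolding mp_well_posed_def by blast
    then have "distr unit_lborel (\<Pi>\<^sub>M j\<in>{t}. borel) (\<lambda>\<omega>. \<lambda>j\<in>{t}. ?X z j \<omega>) =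
        distr unit_lborel (\<Pi>\<^sub>M j\<in>{t}. borel) (\<lambda>\<omega>. \<lambda>j\<in>{t}. ?X z' j \<omega>)"
      unfolding same_fdd_def using t by blast
    moreover have "P v = measure (distr unit_lborel (\<Pi>\<^sub>M j\<in>{t}. borel) (\<lambda>\<omega>. \<lambda>j\<in>{t}. ?X v j \<omega>))
        {g \<in> space (\<Pi>\<^sub>M j\<in>{t}. borel). g t \<in> E}" for v
    proof -
      have [measurable]: "(\<lambda>\<omega>. ?X v s \<omega>) \<in> borel_measurable unit_lborel" for s
        by (rule measurable_path_lim) auto
      show ?thesis
        unfolding P_def
        by (subst measure_distr) (auto intro!: arg_cong[where f = unit.prob] simp: space_PiM)
    qed
    ultimately show ?thesis
      by simp
  qed
  have P_eq: "P z = p x" if "code x z" for x z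
    using code_exists[of x] P_unique[OF that] by metis
  let ?Z = "borel :: ('a \<times> (rat \<Rightarrow> real) \<times> (nat \<Rightarrow> real)) measure"
  have [measurable]: "(\<lambda>v. snd (snd v) n) \<in> borel_measurable ?Z" for n
    by (rule measurable_product_then_coordinatewise) (simp flip: borel_prod)
  have K_meas: "(\<lambda>v. K (snd v) n) \<in> ?Z \<rightarrow>\<^sub>M count_space UNIV" for n
    unfolding K_def by measurable
  have fst_meas: "(\<lambda>v. fst (snd v)) \<in> borel_measurable ?Z" "fst \<in> borel_measurable ?Z"
    by (simp_all flip: borel_prod)
  have \<Theta>_Z: "(\<lambda>(v, \<omega>). \<Theta> (fst (snd v)) \<omega>) \<in> ?Z \<Otimes>\<^sub>M unit_lborel \<rightarrow>\<^sub>M borel"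
  proof -
    have "(\<lambda>w. (fst (snd (fst w)), snd w)) \<in> ?Z \<Otimes>\<^sub>M unit_lborel \<rightarrow>\<^sub>M borel \<Otimes>\<^sub>M unit_lborel"
      by (intro measurable_Pair measurable_compose[OF measurable_fst fst_meas(1)] measurable_snd)
    from measurable_compose[OF this \<Theta>] show ?thesis
      by (simp add: split_beta')
  qed
  have [measurable]: "Measurable.pred ?Z (\<lambda>v. code (fst v) (snd v))"
    unfolding code_def
    by (rule pred_solution_code[OF unit.sigma_finite_measure_axioms K_meas \<Theta>_Z fst_meas(2) Phi_measurable fs_meas B_meas])
  \<comment> \<open>A probability is the integral of an indicator, so Fubini applies to
    \<open>P\<close> as well.\<close>
  have [measurable]: "(\<lambda>v. P (snd v)) \<in> borel_measurable ?Z"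
  proof -
    have [measurable]: "(\<lambda>w. path_lim (K (snd (fst w))) (\<Theta> (fst (snd (fst w))) (snd w)) t) \<in> borel_measurable (?Z \<Otimes>\<^sub>M unit_lborel)"
      by (rule measurable_path_lim[OF measurable_compose[OF measurable_fst K_meas]]) (use \<Theta>_Z in \<open>auto simp: split_beta'\<close>)
    have "(\<lambda>v. LINT \<omega>|unit_lborel. indicator E (path_lim (K (snd v)) (\<Theta> (fst (snd v)) \<omega>) t) :: real) \<in> borel_measurable ?Z"
      by (rule unit.borel_measurable_lebesgue_integral) (unfold split_beta', measurable)
    moreover have "P z = (LINT \<omega>|unit_lborel. indicator E (path_lim (K z) (\<Theta> (fst z) \<omega>) t))" for z
    proof -
      have "(LINT \<omega>|unit_lborel. indicator E (path_lim (K z) (\<Theta> (fst z) \<omega>) t) :: real) =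
          (LINT \<omega>|unit_lborel. indicator {\<omega> \<in> space unit_lborel. path_lim (K z) (\<Theta> (fst z) \<omega>) t \<in> E} \<omega>)"
        by (intro Bochner_Integration.integral_cong) (auto simp: indicator_def)
      also have "\<dots> = P z"
        unfolding P_def Bochner_Integration.integral_indicator by (rule arg_cong[where f = unit.prob]) blast
      finally show ?thesis ..
    qed
    ultimately show ?thesis
      by simp
  qed
  show "(\<lambda>x. measure (M x) {\<omega> \<in> space (M x). X x t \<omega> \<in> E}) \<in> borel_measurable borel"
    unfolding borel_measurable_iff_le p_def[symmetric]
  proof
    fix a
    \<comment> \<open>Since every point has a code, the two projections cover the space; since all
      codes of a point agree on \<open>P\<close>, they are disjoint.\<close>
    let ?G = "{v. code (fst v) (snd v) \<and> P (snd v) \<le> a}" and ?H = "{v. code (fst v) (snd v) \<and> a < P (snd v)}"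
    have "?G \<in> sets borel" "?H \<in> sets borel"
      by measurable
    moreover have img: "fst ` ?G = {x. p x \<le> a}" "fst ` ?H = {x. a < p x}"
      using code_exists P_eq by (force simp: image_iff)+
    ultimately have "fst ` ?G \<in> sets borel"
      by (intro borel_of_complementary_projections[of ?G ?H]) auto
    then show "{x \<in> space borel. p x \<le> a} \<in> sets borel"
      by (simp add: img)
  qed
qed

end
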